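(* Let $\mathbb{P}$ be a Borel probability measure on $\mathbb{H}_+(d)$ such that, for $S\sim\mathbb{P}$, $\mathbb{E}(\operatorname{tr}S)^2<\infty$ and $\mathbb{P}(\mathbb{H}_{++}(d))=1$. Let $\mathbb{A}$ be an affine subspace of $\mathbb{H}(d)$ with $\mathbb{H}_{++}(d)\cap\mathbb{A}\ne\emptyset$, let $S_1,S_2,\dots$ be i.i.d. with law $\mathbb{P}$, and set $$\mathcal{V}_*=\min_{Q\in\mathbb{H}_+(d)\cap\mathbb{A}}\mathbb{E}\,d_{BW}^2(Q,S),\qquad\mathcal{V}_n=\min_{Q\in\mathbb{H}_+(d)\cap\mathbb{A}}\frac1n\sum_{i=1}^nd_{BW}^2(Q,S_i),$$ and let $Q_*$ be the (unique) minimizer in the definition of $\mathcal{V}_*$. Then, as $n\to\infty$, $\sqrt n\,(\mathcal{V}_n-\mathcal{V}_* )$ converges weakly to $\mathcal{N}\bigl(0,\operatorname{Var}d_{BW}^2(Q_*,S)\bigr)$.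
   Context: $\mathbb{H}(d)$ is the real vector space of $d\times d$ complex Hermitian matrices; $\mathbb{H}_+(d)$ and $\mathbb{H}_{++}(d)$ are its subsets of positive semi-definite and positive definite matrices. For $Q,S\in\mathbb{H}_+(d)$ the Bures-Wasserstein distance is $d_{BW}^2(Q,S)=\operatorname{tr}Q+\operatorname{tr}S-2\operatorname{tr}(Q^{1/2}SQ^{1/2})^{1/2}$. *)

theory Defs
  imports "HOL-Probability.Probability"
begin

definition conj_transpose :: "complex^'d^'d \<Rightarrow> complex^'d^'d" where
  "conj_transpose Q = (\<chi> i j. cnj (Q $ j $ i))"

definition hermitian :: "(complex^'d^'d) set" where
  "hermitian = {Q. conj_transpose Q = Q}"

text \<open>For Hermitian \<open>Q\<close> the form \<open>x\<^sup>* Q x\<close> is real, so \<open>Re\<close> discards nothing; likewise for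
  the traces below.\<close>

definition quad_form :: "complex^'d^'d \<Rightarrow> complex^'d \<Rightarrow> real" where
  "quad_form Q x = Re (\<Sum>i\<in>UNIV. cnj (x $ i) * (Q *v x) $ i)"

definition pos_semidef :: "(complex^'d^'d) set" where
  "pos_semidef = {Q \<in> hermitian. \<forall>x. 0 \<le> quad_form Q x}"

definition pos_def :: "(complex^'d^'d) set" where
  "pos_def = {Q \<in> hermitian. \<forall>x. x \<noteq> 0 \<longrightarrow> 0 < quad_form Q x}"

abbreviation re_trace :: "complex^'d^'d \<Rightarrow> real" where
  "re_trace Q \<equiv> Re (trace Q)"

text \<open>Only meaningful for \<open>Q \<in> pos_semidef\<close>, where the positive semi-definite root exists and
  is unique.\<close>

definition psd_sqrt :: "complex^'d^'d \<Rightarrow> complex^'d^'d" where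
  "psd_sqrt Q = (THE R. R \<in> pos_semidef \<and> R ** R = Q)"

definition bw_dist_sq :: "complex^'d^'d \<Rightarrow> complex^'d^'d \<Rightarrow> real" where
  "bw_dist_sq Q S =
     re_trace Q + re_trace S - 2 * re_trace (psd_sqrt (psd_sqrt Q ** S ** psd_sqrt Q))"

definition population_obj :: "(complex^'d^'d) measure \<Rightarrow> complex^'d^'d \<Rightarrow> real" where
  "population_obj P Q = (\<integral>S. bw_dist_sq Q S \<partial>P)"

text \<open>The sample \<open>S\<^sub>1, \<dots>, S\<^sub>n\<close> is indexed as \<open>S 0, \<dots>, S (n - 1)\<close>.\<close>

definition empirical_obj :: "(nat \<Rightarrow> complex^'d^'d) \<Rightarrow> nat \<Rightarrow> complex^'d^'d \<Rightarrow> real" where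
  "empirical_obj S n Q = (1 / real n) * (\<Sum>i<n. bw_dist_sq Q (S i))"

definition psd_minimizer ::
  "(complex^'d^'d) set \<Rightarrow> (complex^'d^'d \<Rightarrow> real) \<Rightarrow> complex^'d^'d \<Rightarrow> bool" where
  "psd_minimizer A F Q \<longleftrightarrow> is_arg_min F (\<lambda>Q. Q \<in> pos_semidef \<inter> A) Q"

text \<open>The minimal value; an infimum is a minimum exactly when a \<open>psd_minimizer\<close> exists.\<close>

definition psd_min_value ::
  "(complex^'d^'d) set \<Rightarrow> (complex^'d^'d \<Rightarrow> real) \<Rightarrow> real" where
  "psd_min_value A F = (INF Q \<in> pos_semidef \<inter> A. F Q)"

text \<open>The law \<open>N(m, v)\<close>. The degenerate case is separate because \<^term>\<open>normal_density m 0\<close>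
  vanishes identically.\<close>

definition normal_law :: "real \<Rightarrow> real \<Rightarrow> real measure" where
  "normal_law m v =
     (if v = 0 then return borel m else density lborel (normal_density m (sqrt v)))"

end

theory Submission
  imports Defs
begin

text \<open>
Write \<open>f\<^sub>Q(S)\<close> for the squared Bures-Wasserstein distance of \<open>Q\<close> and \<open>S\<close>, \<open>E\<close> for the expectation under
\<open>P\<close> and \<open>E\<^sub>n\<close> for the average over the first \<open>n\<close> observations. The minimal empirical value is at most
\<open>E\<^sub>n f\<^sub>Q\<^sub>*\<close>, where \<open>Q\<^sub>*\<close> is the minimizer of \<open>E f\<close>, and the central limit theorem for these averages gives
the asserted limit. So the point is that minimizing over \<open>Q\<close> lowers \<open>E\<^sub>n f\<^sub>Q\<^sub>*\<close> only by \<open>o(n\<^sup>-\<^sup>1\<^sup>/\<^sup>2)\<close> in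
probability. This rests on convexity and on three properties of \<open>Q\<^sub>*\<close>.

For positive definite \<open>Q\<close> and \<open>S\<close> there is a unique positive definite \<open>T\<close> with \<open>T Q T = S\<close>, the optimal
transport map, and \<open>f\<close> has the gradient \<open>I - T\<close> at \<open>Q\<close>. The subgradient inequality
(\<open>bw_dist_sq_subgradient\<close>) comes from completing a square in the dual formula
\<open>2 tr (Q\<^sup>1\<^sup>/\<^sup>2 S Q\<^sup>1\<^sup>/\<^sup>2)\<^sup>1\<^sup>/\<^sup>2 = min {tr (X Q) + tr (X\<^sup>-\<^sup>1 S) | X > 0}\<close>, and it is strict between distinct positive definite matrices.
As \<open>S\<close> is almost surely positive definite, it follows that

\<^item> \<open>Q\<^sub>*\<close> is positive definite, since the gradient blows up like \<open>t\<^sup>-\<^sup>1\<^sup>/\<^sup>2\<close> at distance \<open>t\<close> from a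
  singular matrix (\<open>minimizer_pos_def\<close>);
\<^item> \<open>Q\<^sub>*\<close> is unique (\<open>minimizer_unique\<close>);
\<^item> the expected gradient at \<open>Q\<^sub>*\<close> does not point downwards in any feasible direction
  (\<open>minimizer_first_order\<close>).

For feasible \<open>Q\<close> at distance at most \<open>r\<close> from \<open>Q\<^sub>*\<close>, the subgradient inequality for \<open>E\<^sub>n f\<close> therefore yields
\<open>E\<^sub>n f\<^sub>Q \<ge> E\<^sub>n f\<^sub>Q\<^sub>* - r \<parallel>(E\<^sub>n - E)(I - T)\<parallel>\<close>, and the norm is of order \<open>n\<^sup>-\<^sup>1\<^sup>/\<^sup>2\<close> in probability, because
\<open>\<parallel>T\<parallel>\<^sup>2\<close> is at most a multiple of \<open>tr S\<close>. On the sphere of radius \<open>r\<close> the law of large numbers makes \<open>E\<^sub>n f\<close>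
larger than \<open>E\<^sub>n f\<^sub>Q\<^sub>*\<close>, and by convexity this persists outside the ball. As \<open>r\<close> is arbitrary, the claim
follows. This last argument, \<open>convex_value_central_limit\<close>, is not specific to matrices.
\<close>

section \<open>The trace form and adjoints\<close>
notation conj_transpose ("_\<^sup>\<dagger>" [1000] 999)

lemma conj_transpose_conj_transpose [simp]: "(A\<^sup>\<dagger>)\<^sup>\<dagger> = A"
  by (simp add: vec_eq_iff conj_transpose_def)

lemma conj_transpose_mult: "(A ** B)\<^sup>\<dagger> = B\<^sup>\<dagger> ** A\<^sup>\<dagger>"
  by (simp add: vec_eq_iff conj_transpose_def matrix_matrix_mult_def mult.commute)

lemma conj_transpose_mat [simp]: "(mat c)\<^sup>\<dagger> = mat (cnj c)"
  by (auto simp: vec_eq_iff conj_transpose_def mat_def)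

lemma linear_conj_transpose: "linear conj_transpose"
  by (rule linearI) (simp_all add: vec_eq_iff conj_transpose_def)

lemmas conj_transpose_simps [simp] =
  linear_add [OF linear_conj_transpose] linear_diff [OF linear_conj_transpose]
  linear_scale [OF linear_conj_transpose] linear_0 [OF linear_conj_transpose]
  linear_neg [OF linear_conj_transpose]

lemma bounded_bilinear_matrix_mult:
  "bounded_bilinear ((**) :: complex^'d^'d \<Rightarrow> complex^'d^'d \<Rightarrow> complex^'d^'d)"
  unfolding bilinear_conv_bounded_bilinear [symmetric] bilinear_def
  by (auto intro!: linearI
      simp: vec_eq_iff matrix_matrix_mult_def algebra_simps sum.distrib scaleR_sum_right)

lemma bounded_bilinear_matrix_vector_mult:
  "bounded_bilinear ((*v) :: complex^'d^'d \<Rightarrow> complex^'d \<Rightarrow> complex^'d)"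
  unfolding bilinear_conv_bounded_bilinear [symmetric] bilinear_def
  by (auto intro!: linearI
      simp: vec_eq_iff matrix_vector_mult_def algebra_simps sum.distrib scaleR_sum_right)

interpretation mm: bounded_bilinear "(**) :: complex^'d^'d \<Rightarrow> complex^'d^'d \<Rightarrow> complex^'d^'d"
  by (rule bounded_bilinear_matrix_mult)

interpretation mv: bounded_bilinear "(*v) :: complex^'d^'d \<Rightarrow> complex^'d \<Rightarrow> complex^'d"
  by (rule bounded_bilinear_matrix_vector_mult)

lemma bounded_linear_conj_transpose: "bounded_linear conj_transpose"
  using linear_conj_transpose by (simp add: linear_conv_bounded_linear)

lemmas continuous_on_conj_transpose [continuous_intros] =
  bounded_linear.continuous_on [OF bounded_linear_conj_transpose]

lemma inner_complex_cnj: "x \<bullet> y = Re (cnj x * y)"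
  by (simp add: inner_complex_def)

text \<open>The inner product of \<open>complex^'d^'d\<close>, regarded as a real Euclidean space, is the trace form
\<open>Re tr (A\<^sup>\<dagger> B)\<close>. All traces below are handled as inner products, so that cyclicity of the trace
becomes the two adjunction rules \<open>inner_mult_left\<close> and \<open>inner_mult_right\<close>.\<close>
lemma inner_matrix: "(A :: complex^'d^'d) \<bullet> B = re_trace (A\<^sup>\<dagger> ** B)"
proof -
  have "A \<bullet> B = (\<Sum>i\<in>UNIV. \<Sum>j\<in>UNIV. Re (cnj (A $ i $ j) * B $ i $ j))"
    by (simp add: inner_vec_def inner_complex_cnj del: complex_cnj_mult times_complex.sel)
  also have "\<dots> = (\<Sum>j\<in>UNIV. \<Sum>i\<in>UNIV. Re (cnj (A $ i $ j) * B $ i $ j))"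
    by (rule sum.swap)
  also have "\<dots> = re_trace (A\<^sup>\<dagger> ** B)"
    by (simp add: trace_def matrix_matrix_mult_def conj_transpose_def del: times_complex.sel)
  finally show ?thesis .
qed

lemma re_trace_inner: "re_trace Q = mat 1 \<bullet> (Q :: complex^'d^'d)"
  by (simp add: inner_matrix)

lemma inner_mult_left: "(A ** B) \<bullet> C = B \<bullet> (A\<^sup>\<dagger> ** (C :: complex^'d^'d))"
  by (simp add: inner_matrix conj_transpose_mult matrix_mul_assoc)

lemma inner_mult_right: "(A ** B) \<bullet> C = A \<bullet> ((C :: complex^'d^'d) ** B\<^sup>\<dagger>)"
  using trace_mul_sym [of "B\<^sup>\<dagger>" "A\<^sup>\<dagger> ** C"]
  by (simp add: inner_matrix conj_transpose_mult matrix_mul_assoc)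

lemma inner_matrix_vector: "x \<bullet> (A *v y) = (A\<^sup>\<dagger> *v x) \<bullet> (y :: complex^'d)"
proof -
  have "x \<bullet> (A *v y) = (\<Sum>i\<in>UNIV. \<Sum>j\<in>UNIV. Re (cnj (x $ i) * (A $ i $ j * y $ j)))"
    by (simp add: inner_vec_def inner_complex_cnj matrix_vector_mult_def sum_distrib_left
        del: complex_cnj_mult times_complex.sel)
  also have "\<dots> = (\<Sum>j\<in>UNIV. \<Sum>i\<in>UNIV. Re (cnj (x $ i) * (A $ i $ j * y $ j)))"
    by (rule sum.swap)
  also have "\<dots> = (A\<^sup>\<dagger> *v x) \<bullet> y"
    by (simp add: inner_vec_def inner_complex_cnj matrix_vector_mult_def sum_distrib_right
        conj_transpose_def sum_distrib_left mult_ac del: times_complex.sel)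
  finally show ?thesis .
qed

lemma quad_form_inner: "quad_form Q x = x \<bullet> (Q *v x)"
  by (simp add: quad_form_def inner_vec_def inner_complex_cnj del: times_complex.sel)

section \<open>The cone of positive semi-definite matrices\<close>
lemma hermitianD: "Q \<in> hermitian \<Longrightarrow> Q\<^sup>\<dagger> = Q"
  by (simp add: hermitian_def)

lemma psd_hermitian: "Q \<in> pos_semidef \<Longrightarrow> Q\<^sup>\<dagger> = Q"
  and pos_def_hermitian: "Q \<in> pos_def \<Longrightarrow> Q\<^sup>\<dagger> = Q"
  by (simp_all add: pos_semidef_def pos_def_def hermitian_def)

lemma psd_iff: "Q \<in> pos_semidef \<longleftrightarrow> Q\<^sup>\<dagger> = Q \<and> (\<forall>x. 0 \<le> x \<bullet> (Q *v x))"
  by (simp add: pos_semidef_def hermitian_def quad_form_inner)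

lemma pos_def_iff: "Q \<in> pos_def \<longleftrightarrow> Q\<^sup>\<dagger> = Q \<and> (\<forall>x. x \<noteq> 0 \<longrightarrow> 0 < x \<bullet> (Q *v x))"
  by (simp add: pos_def_def hermitian_def quad_form_inner)

lemma pos_def_imp_psd: "Q \<in> pos_def \<Longrightarrow> Q \<in> pos_semidef"
  unfolding psd_iff pos_def_iff by (metis inner_zero_left order.order_iff_strict)

text \<open>Polarization: a Hermitian form is determined by its diagonal values.\<close>
lemma hermitian_form_eq_0:
  assumes "Y\<^sup>\<dagger> = Y" and "\<And>v. v \<bullet> (Y *v v) = 0"
  shows "Y = 0"
proof -
  have "u \<bullet> (Y *v v) = 0" for u v
  proof -
    have "(u + v) \<bullet> (Y *v (u + v)) = u \<bullet> (Y *v u) + v \<bullet> (Y *v v) + 2 * (u \<bullet> (Y *v v))"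
      using inner_matrix_vector[of v Y u] assms(1)
      by (simp add: matrix_vector_right_distrib inner_add inner_commute)
    then show ?thesis using assms(2) by simp
  qed
  then have "Y *v v = 0" for v by (metis inner_eq_zero_iff)
  then show ?thesis by (metis matrix_eq matrix_vector_mult_0)
qed

lemma psd_congruence: "Q \<in> pos_semidef \<Longrightarrow> B\<^sup>\<dagger> ** Q ** B \<in> pos_semidef"
  using inner_matrix_vector [of _ "B\<^sup>\<dagger>"]
  by (simp add: psd_iff conj_transpose_mult matrix_mul_assoc flip: matrix_vector_mul_assoc)

lemma psd_add: "Q \<in> pos_semidef \<Longrightarrow> R \<in> pos_semidef \<Longrightarrow> Q + R \<in> pos_semidef"
  unfolding psd_iff by (auto simp: mv.add_left inner_add)

lemma pos_def_add: "Q \<in> pos_def \<Longrightarrow> R \<in> pos_semidef \<Longrightarrow> Q + R \<in> pos_def"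
  unfolding psd_iff pos_def_iff by (auto simp: mv.add_left inner_add add_pos_nonneg)

lemma psd_scaleR: "0 \<le> c \<Longrightarrow> Q \<in> pos_semidef \<Longrightarrow> c *\<^sub>R Q \<in> pos_semidef"
  unfolding psd_iff by (auto simp: mv.scaleR_left)

lemma pos_def_scaleR: "0 < c \<Longrightarrow> Q \<in> pos_def \<Longrightarrow> c *\<^sub>R Q \<in> pos_def"
  unfolding pos_def_iff by (auto simp: mv.scaleR_left)

lemma pos_def_mat_1: "mat 1 \<in> pos_def"
  by (auto simp: pos_def_iff)

lemma convex_psd: "convex pos_semidef"
  by (auto simp: convex_def intro!: psd_add psd_scaleR)

lemma closed_psd: "closed pos_semidef"
proof -
  have "pos_semidef = {Q :: complex^'d^'d. Q\<^sup>\<dagger> = Q} \<inter> (\<Inter>x. {Q. 0 \<le> x \<bullet> (Q *v x)})"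
    by (auto simp: psd_iff)
  also have "closed \<dots>"
    by (intro closed_Int closed_INT ballI closed_Collect_eq closed_Collect_le
        continuous_intros mv.continuous_on)
  finally show ?thesis .
qed

section \<open>Diagonalization of Hermitian matrices\<close>
definition outer :: "complex^'d \<Rightarrow> complex^'d^'d" where
  "outer v = (\<chi> i j. v $ i * cnj (v $ j))"

lemma outer_hermitian [simp]: "(outer v)\<^sup>\<dagger> = outer v"
  by (simp add: vec_eq_iff outer_def conj_transpose_def mult.commute)

lemma inner_outer: "Q \<bullet> outer v = v \<bullet> (Q *v v)"
proof -
  have "a \<bullet> (b * cnj c) = b \<bullet> (a * c)" for a b c :: complex
    by (simp add: inner_complex_def algebra_simps)
  then show ?thesis
    by (simp add: inner_vec_def matrix_vector_mult_def outer_def inner_sum_right)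
qed

lemma outer_mult_outer: "outer v ** outer v = (norm v)\<^sup>2 *\<^sub>R outer v"
proof -
  have "(\<Sum>k\<in>UNIV. v $ i * cnj (v $ k) * (v $ k * cnj (v $ j)))
      = of_real ((norm v)\<^sup>2) * (v $ i * cnj (v $ j))" for i j
  proof -
    have "(\<Sum>k\<in>UNIV. v $ i * cnj (v $ k) * (v $ k * cnj (v $ j)))
      = (\<Sum>k\<in>UNIV. (v $ k * cnj (v $ k)) * (v $ i * cnj (v $ j)))"
      by (intro sum.cong) (auto simp: algebra_simps)
    also have "\<dots> = of_real ((norm v)\<^sup>2) * (v $ i * cnj (v $ j))"
      by (simp add: sum_distrib_right norm_vec_def L2_set_def sum_nonneg
         flip: complex_norm_square)
    finally show ?thesis .
  qed
  then show ?thesis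
    by (simp add: vec_eq_iff outer_def matrix_matrix_mult_def scaleR_conv_of_real [where 'a = complex])
qed

text \<open>This is the Cauchy-Schwarz inequality, read as an inequality between matrices. It holds because
\<open>N = \<parallel>v\<parallel>\<^sup>2 I - v v\<^sup>\<dagger>\<close> is a multiple of an orthogonal projection: \<open>N\<^sup>2 = \<parallel>v\<parallel>\<^sup>2 N\<close>.\<close>
lemma outer_le_norm: "((norm v)\<^sup>2 *\<^sub>R mat 1 - outer v) \<in> pos_semidef"
proof (cases "v = 0")
  case True
  then have "outer v = 0" by (simp add: outer_def vec_eq_iff)
  then show ?thesis using True by (simp add: psd_iff)
next
  case False
  define N where "N = (norm v)\<^sup>2 *\<^sub>R mat 1 - outer v"
  have h: "N\<^sup>\<dagger> = N" by (simp add: N_def)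
  have NN: "N ** N = (norm v)\<^sup>2 *\<^sub>R N"
    by (simp add: N_def mm.diff_left mm.diff_right mm.scaleR_left mm.scaleR_right
        outer_mult_outer scaleR_diff_right)
  have "0 \<le> x \<bullet> (N *v x)" for x
  proof -
    have "(norm v)\<^sup>2 * (x \<bullet> (N *v x)) = x \<bullet> (N *v (N *v x))"
      by (simp add: matrix_vector_mul_assoc NN mv.scaleR_left)
    also have "\<dots> = (N *v x) \<bullet> (N *v x)"
      by (simp add: inner_matrix_vector [of x] h)
    finally have "0 \<le> (norm v)\<^sup>2 * (x \<bullet> (N *v x))" by simp
    then show ?thesis using False by (simp add: zero_le_mult_iff)
  qed
  then show ?thesis using h by (simp add: psd_iff N_def)
qed

definition diag :: "('d \<Rightarrow> real) \<Rightarrow> complex^'d^'d" where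
  "diag d = (\<chi> i j. if i = j then complex_of_real (d i) else 0)"

lemma diag_hermitian [simp]: "(diag d)\<^sup>\<dagger> = diag d"
  by (auto simp: vec_eq_iff diag_def conj_transpose_def)

lemma diag_mult_nth: "(diag d ** A) $ i $ j = of_real (d i) * A $ i $ j"
  by (simp add: diag_def matrix_matrix_mult_def if_distrib [of "\<lambda>x. x * _"] cong: if_cong)

lemma mult_diag_nth: "(A ** diag d) $ i $ j = A $ i $ j * of_real (d j)"
  by (simp add: diag_def matrix_matrix_mult_def if_distrib [of "\<lambda>x. _ * x"] cong: if_cong)

lemma diag_mult_diag: "diag d ** diag e = diag (\<lambda>i. d i * e i)"
  by (auto simp: vec_eq_iff diag_mult_nth) (auto simp: diag_def)

lemma diag_form: "x \<bullet> (diag d *v x) = (\<Sum>i\<in>UNIV. d i * (norm (x $ i))\<^sup>2)"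
proof -
  have "(diag d *v x) $ i = d i *\<^sub>R x $ i" for i
    by (simp add: diag_def matrix_vector_mult_def if_distrib [of "\<lambda>x. x * _"]
        scaleR_conv_of_real [where 'a = complex] cong: if_cong)
  then show ?thesis
    by (simp add: inner_vec_def power2_norm_eq_inner)
qed

lemma diag_psd_iff: "diag d \<in> pos_semidef \<longleftrightarrow> (\<forall>i. 0 \<le> d i)"
proof
  assume "diag d \<in> pos_semidef"
  then have *: "0 \<le> axis i 1 \<bullet> (diag d *v axis i (1::complex))" for i by (simp add: psd_iff)
  have "axis i 1 \<bullet> (diag d *v axis i (1::complex)) = d i" for i
    unfolding diag_form
    by (simp add: axis_def if_distrib [of norm] if_distrib [of "\<lambda>x. x^2"]
       if_distrib [of "\<lambda>x. _ * x"] cong: if_cong)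
  then show "\<forall>i. 0 \<le> d i" using * by simp
qed (simp add: psd_iff diag_form sum_nonneg)

lemma mat_central: "mat c ** A = (A :: complex^'d^'d) ** mat c"
  by (simp add: vec_eq_iff mat_def matrix_matrix_mult_def
     if_distrib [of "\<lambda>x. x * _"]  if_distrib [of "\<lambda>x. _ * x"] cong: if_cong)

lemma mat_mult_mat: "mat a ** mat b = (mat (a * b) :: complex^'d^'d)"
  by (simp add: vec_eq_iff mat_def matrix_matrix_mult_def
     if_distrib [of "\<lambda>x. x * _"]  if_distrib [of "\<lambda>x. _ * x"] cong: if_cong)

lemma mat_uminus: "mat (- c) = - (mat c :: complex^'d^'d)"
  by (simp add: vec_eq_iff mat_def)

lemma unitary_right_inverse: "U\<^sup>\<dagger> ** U = mat 1 \<Longrightarrow> U ** U\<^sup>\<dagger> = mat 1"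
  by (metis matrix_left_right_inverse)

lemma compact_unitary: "compact {U :: complex^'d^'d. U\<^sup>\<dagger> ** U = mat 1}"
proof -
  have norm: "norm U = norm (mat 1 :: complex^'d^'d)" if "U\<^sup>\<dagger> ** U = mat 1" for U :: "complex^'d^'d"
    using that inner_mult_left [of U "mat 1" U] by (simp add: norm_eq_sqrt_inner)
  have "bounded {U :: complex^'d^'d. U\<^sup>\<dagger> ** U = mat 1}"
    by (rule boundedI [of _ "norm (mat 1 :: complex^'d^'d)"]) (simp only: mem_Collect_eq norm order_refl)
  moreover have "closed {U :: complex^'d^'d. U\<^sup>\<dagger> ** U = mat 1}"
    by (intro closed_Collect_eq continuous_intros mm.continuous_on)
  ultimately show ?thesis by (simp add: compact_eq_bounded_closed)
qed

text \<open>Fix a real diagonal matrix \<open>C\<close> with distinct entries and let \<open>U\<close> maximize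
\<open>tr (C U\<^sup>\<dagger> Q U)\<close> over the compact unitary group. Stationarity of the maximum along one-parameter
families of unitaries forces \<open>P = U\<^sup>\<dagger> Q U\<close> to commute with \<open>C\<close>, and a matrix that commutes
with \<open>C\<close> is diagonal.\<close>
theorem hermitian_diagonalizable:
  fixes Q :: "complex^'d^'d"
  assumes "Q\<^sup>\<dagger> = Q"
  obtains U d where "U\<^sup>\<dagger> ** U = mat 1" "U ** U\<^sup>\<dagger> = mat 1" "U\<^sup>\<dagger> ** Q ** U = diag d"
proof -
  obtain f :: "'d \<Rightarrow> nat" where "inj f"
    using finite_imp_inj_to_nat_seg [of "UNIV :: 'd set"] by auto
  define c where "c i = real (f i)" for i
  have c: "c i = c j \<Longrightarrow> i = j" for i j
    using \<open>inj f\<close> by (simp add: c_def inj_eq)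
  define C where "C = diag c"
  have [simp]: "C\<^sup>\<dagger> = C" by (simp add: C_def)
  let ?\<phi> = "\<lambda>U. C \<bullet> (U\<^sup>\<dagger> ** Q ** U)"
  have "\<exists>U\<in>{U. U\<^sup>\<dagger> ** U = mat 1}. \<forall>V\<in>{U. U\<^sup>\<dagger> ** U = mat 1}. ?\<phi> V \<le> ?\<phi> U"
    by (intro continuous_attains_sup compact_unitary continuous_intros mm.continuous_on)
       (auto intro: exI [of _ "mat 1"])
  then obtain U where U: "U\<^sup>\<dagger> ** U = mat 1"
    and max: "\<And>V. V\<^sup>\<dagger> ** V = mat 1 \<Longrightarrow> ?\<phi> V \<le> ?\<phi> U" by auto
  define P where "P = U\<^sup>\<dagger> ** Q ** U"
  have [simp]: "P\<^sup>\<dagger> = P" by (simp add: P_def conj_transpose_mult assms matrix_mul_assoc)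
  define X where "X = P ** C - C ** P"
  have Xh: "X\<^sup>\<dagger> = - X" by (simp add: X_def conj_transpose_mult)
  \<comment> \<open>For skew-Hermitian \<open>K\<close> with \<open>K\<^sup>2 = -I\<close> the matrices \<open>cos t I + sin t K\<close> are unitary, and
    \<open>X \<bullet> K\<close> is the derivative at \<open>t = 0\<close> of the objective along them.\<close>
  have XK: "X \<bullet> K = 0" if Kh: "K\<^sup>\<dagger> = - K" and KK: "K ** K = - mat 1" for K
  proof -
    define g where "g t = (cos t)\<^sup>2 * (C \<bullet> P) + cos t * sin t * (X \<bullet> K)
      - (sin t)\<^sup>2 * (C \<bullet> (K ** P ** K))" for t
    have "g t \<le> g 0" for t
    proof -
      define W where "W = cos t *\<^sub>R mat 1 + sin t *\<^sub>R K"
      have W: "W\<^sup>\<dagger> = cos t *\<^sub>R mat 1 - sin t *\<^sub>R K" by (simp add: W_def Kh)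
      have "W\<^sup>\<dagger> ** W = ((cos t)\<^sup>2 + (sin t)\<^sup>2) *\<^sub>R mat 1"
        unfolding W unfolding W_def
        by (simp add: mm.diff_left mm.add_right mm.scaleR_left mm.scaleR_right KK
            scaleR_add_left scaleR_add_right scaleR_diff_right power2_eq_square mult.commute
            del: sin_cos_squared_add sin_cos_squared_add2 sin_cos_squared_add3)
      then have "W\<^sup>\<dagger> ** W = mat 1" by simp
      then have "(U ** W)\<^sup>\<dagger> ** (U ** W) = mat 1"
        using U by (metis conj_transpose_mult matrix_mul_assoc matrix_mul_lid)
      then have "?\<phi> (U ** W) \<le> C \<bullet> P"
        using max unfolding P_def by blast
      moreover have "(U ** W)\<^sup>\<dagger> ** Q ** (U ** W) = W\<^sup>\<dagger> ** P ** W"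
        by (simp add: conj_transpose_mult matrix_mul_assoc P_def)
      moreover have "C \<bullet> (W\<^sup>\<dagger> ** P ** W) = g t"
      proof -
        have "C \<bullet> (P ** K) = (P ** C) \<bullet> K" by (simp add: inner_mult_left)
        moreover have "C \<bullet> (K ** P) = (C ** P) \<bullet> K" by (simp add: inner_mult_right)
        moreover have "W\<^sup>\<dagger> ** P ** W = (cos t)\<^sup>2 *\<^sub>R P + (cos t * sin t) *\<^sub>R (P ** K)
            - (cos t * sin t) *\<^sub>R (K ** P) - (sin t)\<^sup>2 *\<^sub>R (K ** P ** K)"
          unfolding W unfolding W_def
          by (simp add: mm.diff_left mm.add_right mm.scaleR_left mm.scaleR_right
            scaleR_add_left scaleR_diff_right power2_eq_square algebra_simps)
        ultimately show ?thesis
          by (simp add: inner_add inner_diff X_def g_def left_diff_distrib right_diff_distrib)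
      qed
      ultimately show ?thesis by (simp add: g_def)
    qed
    moreover have "(g has_real_derivative (X \<bullet> K)) (at 0)"
      unfolding g_def by (auto intro!: derivative_eq_intros)
    ultimately show ?thesis
      using DERIV_local_max [of g "X \<bullet> K" 0 1] by auto
  qed
  \<comment> \<open>\<open>Y = -\<i>X\<close> is Hermitian and, as a commutator, has trace \<open>0\<close>; testing against
    \<open>K = \<i>(I - 2vv\<^sup>\<dagger>)\<close> shows that its quadratic form vanishes at every unit vector \<open>v\<close>.\<close>
  define Y where "Y = mat (- \<i>) ** X"
  have Yh: "Y\<^sup>\<dagger> = Y"
  proof -
    have "Y\<^sup>\<dagger> = (- X) ** mat \<i>" by (simp add: Y_def conj_transpose_mult Xh)
    also have "\<dots> = mat \<i> ** (- X)" by (rule mat_central [symmetric])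
    also have "\<dots> = Y" 
      by (simp add: Y_def mat_uminus mm.minus_left mm.minus_right)
    finally show ?thesis .
  qed
  have Y1: "Y \<bullet> mat 1 = 0"
  proof -
    have "Y \<bullet> mat 1 = X \<bullet> mat \<i>" by (simp add: Y_def inner_mult_left)
    also have "\<dots> = C \<bullet> (P ** mat \<i>) - C \<bullet> (mat \<i> ** P)"
      unfolding X_def inner_diff_left inner_mult_left [of P C] inner_mult_right [of C P] by simp
    finally show ?thesis by (simp add: mat_central)
  qed
  have unit: "v \<bullet> (Y *v v) = 0" if "norm v = 1" for v
  proof -
    define H where "H = mat 1 - 2 *\<^sub>R outer v"
    define K where "K = mat \<i> ** H"
    have HH: "H ** H = mat 1"
      using that by (simp add: H_def mm.diff_left mm.diff_right mm.scaleR_left mm.scaleR_right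
         outer_mult_outer) (simp add: vec_eq_iff scaleR_conv_of_real [where 'a = complex])
    have Hh: "H\<^sup>\<dagger> = H" by (simp add: H_def)
    have "K\<^sup>\<dagger> = - K"
      by (simp add: K_def conj_transpose_mult Hh mat_uminus mm.minus_left mm.minus_right mat_central [of "\<i>" H])
    moreover have "K ** K = (mat \<i> ** mat \<i>) ** (H ** H)"
      unfolding K_def by (metis mat_central matrix_mul_assoc)
    then have "K ** K = - mat 1" by (simp add: HH mat_mult_mat mat_uminus)
    ultimately have "X \<bullet> K = 0" by (rule XK)
    moreover have "X \<bullet> K = Y \<bullet> H"
      by (simp add: K_def Y_def inner_mult_left)
    ultimately show ?thesis
      using Y1 by (simp add: H_def inner_diff_right inner_outer)
  qed
  have "v \<bullet> (Y *v v) = 0" for v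
  proof (cases "v = 0")
    case False
    have "(v /\<^sub>R norm v) \<bullet> (Y *v (v /\<^sub>R norm v)) = 0"
      using False by (intro unit) simp
    then show ?thesis using False by (simp add: mv.scaleR_right)
  qed simp
  then have "Y = 0" by (rule hermitian_form_eq_0 [OF Yh])
  then have "mat \<i> ** Y = 0" by simp
  then have "X = 0" by (simp add: Y_def matrix_mul_assoc mat_mult_mat)
  then have "(P ** C) $ i $ j = (C ** P) $ i $ j" for i j
    by (simp add: X_def)
  then have off: "P $ i $ j = 0" if "i \<noteq> j" for i j
    using that c by (auto simp: C_def diag_mult_nth mult_diag_nth)
  have "P = diag (\<lambda>i. Re (P $ i $ i))"
  proof -
    have "cnj (P $ i $ i) = P $ i $ i" for i
      using \<open>P\<^sup>\<dagger> = P\<close> by (simp add: conj_transpose_def vec_eq_iff)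
    then have "P $ i $ i = of_real (Re (P $ i $ i))" for i
      by (metis Reals_cnj_iff of_real_Re)
    then show ?thesis using off by (auto simp: vec_eq_iff diag_def)
  qed
  then show thesis
    using that U unitary_right_inverse unfolding P_def by blast
qed

section \<open>Square roots and matrix inequalities\<close>
lemma psd_sqrt_exists:
  assumes "Q \<in> pos_semidef"
  obtains R where "R \<in> pos_semidef" "R ** R = Q"
proof -
  obtain U d where U: "U\<^sup>\<dagger> ** U = mat 1" "U ** U\<^sup>\<dagger> = mat 1" and d: "U\<^sup>\<dagger> ** Q ** U = diag d"
    using hermitian_diagonalizable psd_hermitian [OF assms] by metis
  have "diag d \<in> pos_semidef"
    using psd_congruence [OF assms, of U] by (simp add: d)
  then have d0: "0 \<le> d i" for i by (simp add: diag_psd_iff)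
  define E where "E = diag (\<lambda>i. sqrt (d i))"
  have EE: "E ** E = diag d" using d0 by (simp add: E_def diag_mult_diag)
  have "E \<in> pos_semidef" using d0 by (simp add: E_def diag_psd_iff)
  then have "U ** E ** U\<^sup>\<dagger> \<in> pos_semidef"
    using psd_congruence [of E "U\<^sup>\<dagger>"] by simp
  moreover have "(U ** E ** U\<^sup>\<dagger>) ** (U ** E ** U\<^sup>\<dagger>) = U ** (E ** (U\<^sup>\<dagger> ** U) ** E) ** U\<^sup>\<dagger>"
    by (simp only: matrix_mul_assoc)
  moreover have "U ** (E ** (U\<^sup>\<dagger> ** U) ** E) ** U\<^sup>\<dagger> = (U ** U\<^sup>\<dagger>) ** Q ** (U ** U\<^sup>\<dagger>)"
    by (simp only: U(1) matrix_mul_rid EE) (simp only: d [symmetric] matrix_mul_assoc)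
  ultimately show thesis
    using that U(2) by simp
qed

text \<open>With \<open>D = R - S\<close>, the equation \<open>R\<^sup>2 = S\<^sup>2\<close> says \<open>R D + D S = 0\<close>. Multiplying by \<open>D\<close> and taking traces
gives two nonnegative numbers \<open>tr (D R D)\<close> and \<open>tr (D S D)\<close> with sum \<open>0\<close>, whence \<open>R D = S D = 0\<close>
and \<open>D\<^sup>2 = 0\<close>.\<close>
lemma psd_square_inj:
  fixes R S :: "complex^'d^'d"
  assumes R: "R \<in> pos_semidef" and S: "S \<in> pos_semidef" and eq: "R ** R = S ** S"
  shows "R = S"
proof -
  obtain B where B: "B \<in> pos_semidef" "B ** B = R" using psd_sqrt_exists [OF R] .
  obtain C where C: "C \<in> pos_semidef" "C ** C = S" using psd_sqrt_exists [OF S] .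
  define D where "D = R - S"
  have Dh: "D\<^sup>\<dagger> = D" by (simp add: D_def psd_hermitian R S)
  have 1: "R ** D + D ** S = 0" by (simp add: D_def mm.diff_left mm.diff_right eq)
  have 2: "D \<bullet> (R ** D) = (B ** D) \<bullet> (B ** D)"
    by (simp add: inner_mult_left [of B] psd_hermitian B(1) matrix_mul_assoc B(2))
  have 3: "D \<bullet> (D ** S) = (D ** C) \<bullet> (D ** C)"
    by (simp add: inner_mult_right [of _ C] psd_hermitian C(1) flip: matrix_mul_assoc)
       (simp add: C(2))
  have "D \<bullet> (R ** D) + D \<bullet> (D ** S) = 0"
    using 1 by (simp flip: inner_add_right)
  then have "B ** D = 0" "D ** C = 0"
    unfolding 2 3 by (simp_all add: add_nonneg_eq_0_iff)
  then have "R ** D = 0" "D ** S = 0"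
    by (metis B(2) matrix_mul_assoc mm.zero_right) (metis \<open>D ** C = 0\<close> C(2) matrix_mul_assoc mm.zero_left)
  moreover have "S ** D = (D ** S)\<^sup>\<dagger>" by (simp add: conj_transpose_mult Dh psd_hermitian S)
  ultimately have "D ** D = 0"
    by (simp add: D_def mm.diff_left)
  then have "D \<bullet> D = 0"
    using inner_mult_right [of "mat 1" D D] by (simp add: Dh)
  then show ?thesis by (simp add: D_def)
qed

lemma psd_sqrt_unique: "R \<in> pos_semidef \<Longrightarrow> R ** R = Q \<Longrightarrow> psd_sqrt Q = R"
  unfolding psd_sqrt_def by (rule the_equality) (auto intro: psd_square_inj)

lemma psd_sqrt_psd: "Q \<in> pos_semidef \<Longrightarrow> psd_sqrt Q \<in> pos_semidef"
  and psd_sqrt_mult: "Q \<in> pos_semidef \<Longrightarrow> psd_sqrt Q ** psd_sqrt Q = Q"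
  by (metis psd_sqrt_exists psd_sqrt_unique)+

lemma psd_form_eq_0:
  assumes "Q \<in> pos_semidef" "x \<bullet> (Q *v x) = 0"
  shows "Q *v x = 0"
proof -
  obtain B where B: "B \<in> pos_semidef" "B ** B = Q" using psd_sqrt_exists assms(1) .
  have "(B *v x) \<bullet> (B *v x) = 0"
    using assms(2) by (simp add: B(2) [symmetric] inner_matrix_vector [of x] psd_hermitian B(1)
        flip: matrix_vector_mul_assoc)
  then show ?thesis by (simp add: B(2) [symmetric] flip: matrix_vector_mul_assoc)
qed

lemma psd_imp_pos_def:
  assumes "Q \<in> pos_semidef" "\<And>x. Q *v x = 0 \<Longrightarrow> x = 0"
  shows "Q \<in> pos_def"
  using assms psd_form_eq_0 unfolding pos_def_iff psd_iff by (metis order_le_less)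

lemma pos_def_ker: "Q \<in> pos_def \<Longrightarrow> Q *v x = 0 \<Longrightarrow> x = 0"
  unfolding pos_def_iff by force

lemma inner_psd_nonneg:
  assumes "A \<in> pos_semidef" "N \<in> pos_semidef"
  shows "0 \<le> A \<bullet> N"
proof -
  obtain B where B: "B \<in> pos_semidef" "B ** B = A" using psd_sqrt_exists assms(1) .
  obtain C where C: "C \<in> pos_semidef" "C ** C = N" using psd_sqrt_exists assms(2) .
  have "A \<bullet> N = (A ** C) \<bullet> C"
    by (simp add: inner_mult_right psd_hermitian C)
  also have "\<dots> = (B ** C) \<bullet> (B ** C)"
    by (simp add: B(2) [symmetric] inner_mult_left psd_hermitian B(1) flip: matrix_mul_assoc)
  finally show ?thesis by simp
qed

lemma inner_mono: "A \<in> pos_semidef \<Longrightarrow> N - M \<in> pos_semidef \<Longrightarrow> A \<bullet> M \<le> A \<bullet> N"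
  using inner_psd_nonneg [of A "N - M"] by (simp add: inner_diff_right)

lemma inner_mat_1 [simp]: "A \<bullet> mat 1 = re_trace A" "mat 1 \<bullet> A = re_trace A"
  by (simp_all add: re_trace_inner inner_commute)

lemma re_trace_psd_nonneg: "A \<in> pos_semidef \<Longrightarrow> 0 \<le> re_trace A"
  using inner_psd_nonneg [of A "mat 1"] by (simp add: pos_def_imp_psd pos_def_mat_1)

lemma psd_le_trace:
  assumes "Q \<in> pos_semidef"
  shows "re_trace Q *\<^sub>R mat 1 - Q \<in> pos_semidef"
proof -
  have "x \<bullet> (Q *v x) \<le> re_trace Q * (x \<bullet> x)" for x
    using inner_mono [OF assms outer_le_norm [of x]]
    by (simp add: inner_outer mult.commute power2_norm_eq_inner)
  then show ?thesis
    using psd_hermitian [OF assms] by (simp add: psd_iff mv.diff_left mv.scaleR_left inner_diff_right)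
qed

lemma norm_psd_le_trace:
  assumes "Q \<in> pos_semidef"
  shows "norm Q \<le> re_trace Q"
proof -
  have "(norm Q)\<^sup>2 \<le> (re_trace Q)\<^sup>2"
    using inner_mono [OF assms psd_le_trace [OF assms]]
    by (simp add: power2_norm_eq_inner) (simp add: power2_eq_square)
  then show ?thesis
    using re_trace_psd_nonneg [OF assms] by (rule power2_le_imp_le)
qed

lemma norm_outer: "norm (outer x) = (norm x)\<^sup>2"
proof -
  have tr: "re_trace (outer x) = (norm x)\<^sup>2"
    using inner_outer [of "mat 1" x] by (simp add: power2_norm_eq_inner)
  have "(norm (outer x))\<^sup>2 = re_trace (outer x ** outer x)"
    by (simp add: power2_norm_eq_inner inner_matrix)
  also have "\<dots> = (norm x)\<^sup>2 * re_trace (outer x)"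
    by (simp only: outer_mult_outer) (simp add: trace_def sum_distrib_left)
  also have "\<dots> = ((norm x)\<^sup>2)\<^sup>2"
    using tr by (simp add: power2_eq_square)
  finally show ?thesis by (rule power2_eq_imp_eq) simp_all
qed

lemma pos_def_lower_bound:
  fixes Q :: "complex^'d^'d"
  assumes "Q \<in> pos_def"
  obtains \<delta> where "0 < \<delta>" "Q - \<delta> *\<^sub>R mat 1 \<in> pos_semidef"
proof -
  have "axis undefined 1 \<in> sphere (0 :: complex^'d) 1" by (simp add: norm_axis_1)
  then have "\<exists>x\<in>sphere (0 :: complex^'d) 1. \<forall>y\<in>sphere 0 1. x \<bullet> (Q *v x) \<le> y \<bullet> (Q *v y)"
    by (intro continuous_attains_inf continuous_intros mv.continuous_on) auto
  then obtain x :: "complex^'d" where x: "norm x = 1"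
    and min: "\<And>y. norm y = 1 \<Longrightarrow> x \<bullet> (Q *v x) \<le> y \<bullet> (Q *v y)" by auto
  define \<delta> where "\<delta> = x \<bullet> (Q *v x)"
  have "x \<noteq> 0" using x by auto
  then have "\<delta> > 0" using assms unfolding pos_def_iff \<delta>_def by blast
  moreover have "\<delta> * (y \<bullet> y) \<le> y \<bullet> (Q *v y)" for y
  proof (cases "y = 0")
    case False
    then have "\<delta> \<le> (y /\<^sub>R norm y) \<bullet> (Q *v (y /\<^sub>R norm y))"
      unfolding \<delta>_def by (intro min) simp
    then show ?thesis
      using False by (simp add: mv.scaleR_right field_simps power2_eq_square flip: power2_norm_eq_inner)
  qed simp
  then have "Q - \<delta> *\<^sub>R mat 1 \<in> pos_semidef"
    using pos_def_hermitian [OF assms]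
    by (simp add: psd_iff mv.diff_left mv.scaleR_left inner_diff_right)
  ultimately show thesis by (rule that)
qed

text \<open>The smallest eigenvalue is 1-Lipschitz for the Frobenius norm. Lower bounds \<open>Q \<ge> \<delta> I\<close>,
written as \<open>Q - \<delta> I \<in> pos_semidef\<close>, replace eigenvalues throughout.\<close>
lemma psd_lower_bound_perturb:
  assumes "Q - \<delta> *\<^sub>R mat 1 \<in> pos_semidef" "Q' \<in> hermitian" "norm (Q' - Q) \<le> \<epsilon>"
  shows "Q' - (\<delta> - \<epsilon>) *\<^sub>R mat 1 \<in> pos_semidef"
proof -
  have h: "Q\<^sup>\<dagger> = Q"
    using psd_hermitian [OF assms(1)] by simp
  have "0 \<le> x \<bullet> ((Q' - (\<delta> - \<epsilon>) *\<^sub>R mat 1) *v x)" for x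
  proof -
    have "(Q - Q') \<bullet> outer x \<le> norm (Q - Q') * norm (outer x)" by (rule norm_cauchy_schwarz)
    also have "\<dots> \<le> \<epsilon> * (norm x)\<^sup>2"
      using assms(3) by (simp add: norm_outer norm_minus_commute mult_right_mono)
    finally have "x \<bullet> (Q *v x) - x \<bullet> (Q' *v x) \<le> \<epsilon> * (x \<bullet> x)"
      by (simp add: inner_outer power2_norm_eq_inner mv.diff_left inner_diff_right)
    moreover have "0 \<le> x \<bullet> ((Q - \<delta> *\<^sub>R mat 1) *v x)" using assms(1) by (simp add: psd_iff)
    ultimately show ?thesis
      by (simp add: mv.diff_left mv.scaleR_left inner_diff_right left_diff_distrib)
  qed
  then show ?thesis using hermitianD [OF assms(2)] by (simp add: psd_iff)
qed

lemma pos_def_of_lower_bound: "0 < \<delta> \<Longrightarrow> Q - \<delta> *\<^sub>R mat 1 \<in> pos_semidef \<Longrightarrow> Q \<in> pos_def"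
  using pos_def_add [OF pos_def_scaleR [OF _ pos_def_mat_1], of \<delta> "Q - \<delta> *\<^sub>R mat 1"] by simp

lemma pos_def_inverse:
  fixes Q :: "complex^'d^'d"
  assumes "Q \<in> pos_def"
  obtains B where "B \<in> pos_def" "Q ** B = mat 1" "B ** Q = mat 1"
proof -
  obtain B where B: "B ** Q = mat 1"
    using matrix_left_invertible_ker [of Q] pos_def_ker [OF assms] by auto
  then have B': "Q ** B = mat 1" by (metis matrix_left_right_inverse)
  have "B\<^sup>\<dagger> = B\<^sup>\<dagger> ** (Q ** B)" by (simp add: B')
  also have "\<dots> = (Q ** B)\<^sup>\<dagger> ** B"
    by (simp add: conj_transpose_mult pos_def_hermitian assms matrix_mul_assoc)
  finally have "B\<^sup>\<dagger> = B" by (simp add: B')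
  then have "B \<in> pos_semidef"
    using psd_congruence [OF pos_def_imp_psd [OF assms], of B] by (simp add: B)
  moreover have "x = 0" if "B *v x = 0" for x
    using that B' by (metis matrix_vector_mul_assoc matrix_vector_mul_lid mv.zero_right)
  ultimately have "B \<in> pos_def" by (rule psd_imp_pos_def)
  then show thesis using that B B' by blast
qed

lemma pos_def_inner_eq_0:
  assumes "A \<in> pos_def" "N \<in> pos_semidef" "A \<bullet> N = 0"
  shows "N = 0"
proof -
  obtain \<delta> where \<delta>: "0 < \<delta>" "A - \<delta> *\<^sub>R mat 1 \<in> pos_semidef" using pos_def_lower_bound assms(1) .
  have "\<delta> * re_trace N \<le> 0"
    using inner_mono [OF assms(2) \<delta>(2)] assms(3) by (simp add: inner_commute)
  then have "re_trace N \<le> 0" using \<delta>(1) by (simp add: mult_le_0_iff)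
  then show ?thesis using norm_psd_le_trace [OF assms(2)] by (metis norm_le_zero_iff order_trans)
qed

section \<open>Optimal transport maps\<close>

text \<open>The matrix of the optimal transport map from the centred Gaussian law with covariance \<open>Q\<close> to the
one with covariance \<open>S\<close>. It is well defined for \<open>Q \<in> pos_def\<close> and \<open>S \<in> pos_semidef\<close>.
Characterizing it by \<open>T Q T = S\<close> instead of \<open>Q\<^sup>-\<^sup>1\<^sup>/\<^sup>2 (Q\<^sup>1\<^sup>/\<^sup>2 S Q\<^sup>1\<^sup>/\<^sup>2)\<^sup>1\<^sup>/\<^sup>2 Q\<^sup>-\<^sup>1\<^sup>/\<^sup>2\<close> makes
continuity in \<open>Q\<close> and \<open>S\<close> a compactness argument.\<close>
definition ot_map :: "complex^'d^'d \<Rightarrow> complex^'d^'d \<Rightarrow> complex^'d^'d" where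
  "ot_map Q S = (THE T. T \<in> pos_semidef \<and> T ** Q ** T = S)"

lemma psd_sandwich: "Q \<in> pos_semidef \<Longrightarrow> B \<in> pos_semidef \<Longrightarrow> B ** Q ** B \<in> pos_semidef"
  using psd_congruence [of Q B] by (simp add: psd_hermitian)

text \<open>The nested square root in the definition of the distance disappears once \<open>S\<close> is written as
\<open>T Q T\<close>: with \<open>R = Q\<^sup>1\<^sup>/\<^sup>2\<close>, the matrix \<open>R T R\<close> squares to \<open>R (T Q T) R\<close>.\<close>
lemma psd_sqrt_sandwich:
  assumes "Q \<in> pos_semidef" "T \<in> pos_semidef"
  shows "psd_sqrt (psd_sqrt Q ** (T ** Q ** T) ** psd_sqrt Q) = psd_sqrt Q ** T ** psd_sqrt Q"
proof (rule psd_sqrt_unique)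
  let ?R = "psd_sqrt Q"
  show "?R ** T ** ?R \<in> pos_semidef"
    by (intro psd_sandwich psd_sqrt_psd assms)
  have "?R ** T ** ?R ** (?R ** T ** ?R) = ?R ** (T ** (?R ** ?R) ** T) ** ?R"
    by (simp only: matrix_mul_assoc)
  then show "?R ** T ** ?R ** (?R ** T ** ?R) = ?R ** (T ** Q ** T) ** ?R"
    by (simp add: psd_sqrt_mult assms)
qed

lemma pos_def_sqrt:
  assumes "Q \<in> pos_def"
  shows "psd_sqrt Q \<in> pos_def"
proof (rule psd_imp_pos_def)
  note Q = pos_def_imp_psd [OF assms]
  show "psd_sqrt Q \<in> pos_semidef" using Q by (rule psd_sqrt_psd)
  show "x = 0" if "psd_sqrt Q *v x = 0" for x
    using pos_def_ker [OF assms] that psd_sqrt_mult [OF Q]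
    by (metis matrix_vector_mul_assoc mv.zero_right)
qed

text \<open>By \<open>psd_sqrt_sandwich\<close> every solution \<open>T\<close> satisfies \<open>R T R = (R S R)\<^sup>1\<^sup>/\<^sup>2\<close> for \<open>R = Q\<^sup>1\<^sup>/\<^sup>2\<close>, and \<open>R\<close> is
invertible, so this can be solved for \<open>T\<close>.\<close>
lemma ot_map_ex1:
  assumes Q: "Q \<in> pos_def" and S: "S \<in> pos_semidef"
  shows "\<exists>!T. T \<in> pos_semidef \<and> T ** Q ** T = S"
proof -
  note Qs = pos_def_imp_psd [OF Q]
  let ?R = "psd_sqrt Q"
  obtain B where B: "B \<in> pos_def" "?R ** B = mat 1" "B ** ?R = mat 1"
    using pos_def_inverse pos_def_sqrt [OF Q] .
  have Bs: "B \<in> pos_semidef" using B(1) by (rule pos_def_imp_psd)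
  let ?G = "psd_sqrt (?R ** S ** ?R)"
  have RSR: "?R ** S ** ?R \<in> pos_semidef" by (intro psd_sandwich psd_sqrt_psd Qs S)
  have cancel: "B ** (?R ** X ** ?R) ** B = X" for X
  proof -
    have "B ** (?R ** X ** ?R) ** B = (B ** ?R) ** X ** (?R ** B)" by (simp only: matrix_mul_assoc)
    then show ?thesis by (simp add: B)
  qed
  show ?thesis
  proof (rule ex1I)
    have "B ** ?G ** B ** Q ** (B ** ?G ** B)
        = B ** ?G ** (B ** ?R) ** (?R ** B) ** ?G ** B"
      by (subst psd_sqrt_mult [OF Qs, symmetric]) (simp only: matrix_mul_assoc)
    also have "\<dots> = B ** (?G ** ?G) ** B" by (simp add: B matrix_mul_assoc)
    also have "\<dots> = S" by (simp add: psd_sqrt_mult RSR cancel)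
    finally show "B ** ?G ** B \<in> pos_semidef \<and> B ** ?G ** B ** Q ** (B ** ?G ** B) = S"
      using RSR Bs by (simp add: psd_sandwich psd_sqrt_psd)
  next
    fix T assume "T \<in> pos_semidef \<and> T ** Q ** T = S"
    then have "?G = ?R ** T ** ?R" using psd_sqrt_sandwich Qs by metis
    then show "T = B ** ?G ** B" by (simp add: cancel)
  qed
qed

lemma
  assumes "Q \<in> pos_def" "S \<in> pos_semidef"
  shows ot_map_psd: "ot_map Q S \<in> pos_semidef"
    and ot_map_push: "ot_map Q S ** Q ** ot_map Q S = S"
  using theI' [OF ot_map_ex1 [OF assms]] by (auto simp: ot_map_def)

lemma ot_map_unique:
  "Q \<in> pos_def \<Longrightarrow> T \<in> pos_semidef \<Longrightarrow> T ** Q ** T = S \<Longrightarrow> ot_map Q S = T"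
  using ot_map_ex1 [of Q S] ot_map_psd ot_map_push psd_sandwich pos_def_imp_psd by metis

lemma ot_map_id: "S \<in> pos_semidef \<Longrightarrow> ot_map (mat 1) S = psd_sqrt S"
  by (rule ot_map_unique) (simp_all add: pos_def_mat_1 psd_sqrt_psd psd_sqrt_mult)

lemma ot_map_pos_def:
  assumes "Q \<in> pos_def" "S \<in> pos_def"
  shows "ot_map Q S \<in> pos_def"
proof (rule psd_imp_pos_def)
  note S = pos_def_imp_psd [OF assms(2)]
  show "ot_map Q S \<in> pos_semidef" using assms(1) S by (rule ot_map_psd)
  fix x assume "ot_map Q S *v x = 0"
  then have "S *v x = 0"
    using ot_map_push [OF assms(1) S] by (metis matrix_vector_mul_assoc mv.zero_right)
  then show "x = 0" by (rule pos_def_ker [OF assms(2)])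
qed

text \<open>Since \<open>tr S = tr (T Q T) = tr (Q T\<^sup>2) \<ge> \<delta> tr (T\<^sup>2)\<close>.\<close>
lemma norm_ot_map_le:
  assumes "0 < \<delta>" "Q - \<delta> *\<^sub>R mat 1 \<in> pos_semidef" "S \<in> pos_semidef"
  shows "norm (ot_map Q S) \<le> sqrt (re_trace S / \<delta>)"
proof -
  define T where "T = ot_map Q S"
  have Q: "Q \<in> pos_def" using assms(1,2) by (rule pos_def_of_lower_bound)
  have T: "T \<in> pos_semidef" "T ** Q ** T = S"
    unfolding T_def using Q assms(3) by (rule ot_map_psd, rule ot_map_push)
  have TT: "T ** T \<in> pos_semidef"
    using psd_congruence [OF pos_def_imp_psd [OF pos_def_mat_1], of T] by (simp add: psd_hermitian T)
  have "re_trace S = (T ** (Q ** T)) \<bullet> mat 1" by (simp add: T matrix_mul_assoc)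
  also have "\<dots> = (Q ** T) \<bullet> T"
    by (simp only: inner_mult_left [of T] psd_hermitian T matrix_mul_rid)
  also have "\<dots> = Q \<bullet> (T ** T)"
    by (simp only: inner_mult_right [of Q] psd_hermitian T)
  also have "\<dots> = (T ** T) \<bullet> Q" by (rule inner_commute)
  finally have "\<delta> * re_trace (T ** T) \<le> re_trace S"
    using inner_mono [OF TT assms(2)] by simp
  moreover have "re_trace (T ** T) = (norm T)\<^sup>2"
    by (simp add: power2_norm_eq_inner inner_matrix psd_hermitian T)
  ultimately have "(norm T)\<^sup>2 \<le> re_trace S / \<delta>"
    using assms(1) by (simp add: field_simps)
  then show ?thesis by (simp add: T_def real_le_rsqrt)
qed

lemma bounded_unique_limit_tendsto:
  fixes X :: "nat \<Rightarrow> 'a::heine_borel"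
  assumes "bounded (range X)"
    and unique: "\<And>r L. strict_mono r \<Longrightarrow> (X \<circ> r) \<longlonglongrightarrow> L \<Longrightarrow> L = l"
  shows "X \<longlonglongrightarrow> l"
proof (rule ccontr)
  assume "\<not> X \<longlonglongrightarrow> l"
  then obtain e where "e > 0" and "\<not> (\<forall>\<^sub>F n in sequentially. dist (X n) l < e)"
    unfolding tendsto_iff by blast
  then have "infinite {n. \<not> dist (X n) l < e}"
    by (simp add: not_eventually flip: cofinite_eq_sequentially frequently_cofinite)
  then obtain r :: "nat \<Rightarrow> nat" where r: "strict_mono r" "\<And>n. \<not> dist (X (r n)) l < e"
    using infinite_enumerate by blast
  have "bounded (range (X \<circ> r))"
    using assms(1) by (rule bounded_subset) auto
  then obtain L s where s: "strict_mono s" "((X \<circ> r) \<circ> s) \<longlonglongrightarrow> L"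
    using bounded_imp_convergent_subsequence by metis
  have "strict_mono (r \<circ> s)" using r(1) s(1) by (rule strict_mono_o)
  then have "L = l" using s(2) unique [of "r \<circ> s" L] by (simp add: o_assoc)
  with s(2) have "\<forall>\<^sub>F n in sequentially. dist (((X \<circ> r) \<circ> s) n) l < e"
    using \<open>e > 0\<close> unfolding tendsto_iff by blast
  then show False using r(2) by (simp add: eventually_sequentially)
qed

text \<open>The maps are bounded by \<open>norm_ot_map_le\<close>, and every limit point \<open>L\<close> satisfies \<open>L Q L = S\<close>, which has
only one solution. The case \<open>Q = I\<close> is the continuity of the square root.\<close>
lemma ot_map_tendsto:
  fixes Qn :: "nat \<Rightarrow> complex^'d^'d"
  assumes "0 < \<delta>" and Qn: "\<And>n. Qn n - \<delta> *\<^sub>R mat 1 \<in> pos_semidef" and Q: "Qn \<longlonglongrightarrow> Q"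
    and Sn: "\<And>n. Sn n \<in> pos_semidef" and S: "Sn \<longlonglongrightarrow> S"
  shows "(\<lambda>n. ot_map (Qn n) (Sn n)) \<longlonglongrightarrow> ot_map Q S"
proof (rule bounded_unique_limit_tendsto)
  let ?T = "\<lambda>n. ot_map (Qn n) (Sn n)"
  have Qn_pd: "Qn n \<in> pos_def" for n using assms(1) Qn by (rule pos_def_of_lower_bound)
  have "(\<lambda>n. Qn n - \<delta> *\<^sub>R mat 1) \<longlonglongrightarrow> Q - \<delta> *\<^sub>R mat 1" by (intro tendsto_intros Q)
  then have "Q - \<delta> *\<^sub>R mat 1 \<in> pos_semidef" by (rule closed_sequentially [OF closed_psd Qn])
  then have Qpd: "Q \<in> pos_def" using assms(1) by (rule pos_def_of_lower_bound [rotated])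
  have Spsd: "S \<in> pos_semidef"
    using closed_sequentially [OF closed_psd Sn S] .
  show "bounded (range ?T)"
  proof -
    from S have "bounded (range Sn)" by (rule convergent_imp_bounded)
    then obtain b where b: "\<And>n. norm (Sn n) \<le> b" unfolding bounded_iff by blast
    have "norm (?T n) \<le> sqrt (norm (mat 1 :: complex^'d^'d) * b / \<delta>)" for n
    proof -
      have "re_trace (Sn n) \<le> norm (mat 1 :: complex^'d^'d) * norm (Sn n)"
        unfolding re_trace_inner by (rule norm_cauchy_schwarz)
      also have "\<dots> \<le> norm (mat 1 :: complex^'d^'d) * b" by (intro mult_left_mono b) simp
      finally show ?thesis
        using assms(1) norm_ot_map_le [OF assms(1) Qn Sn, of n n]
        by (meson divide_right_mono less_imp_le order_trans real_sqrt_le_mono)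
    qed
    then show ?thesis unfolding bounded_iff by blast
  qed
  fix r :: "nat \<Rightarrow> nat" and L
  assume r: "strict_mono r" and L: "(?T \<circ> r) \<longlonglongrightarrow> L"
  have "L \<in> pos_semidef"
    by (rule closed_sequentially [OF closed_psd _ L]) (simp add: ot_map_psd Qn_pd Sn)
  moreover have "L ** Q ** L = S"
  proof (rule LIMSEQ_unique)
    show "(Sn \<circ> r) \<longlonglongrightarrow> S" using S r by (rule LIMSEQ_subseq_LIMSEQ)
    have "(\<lambda>n. (?T \<circ> r) n ** (Qn \<circ> r) n ** (?T \<circ> r) n) \<longlonglongrightarrow> L ** Q ** L"
      by (intro mm.tendsto L LIMSEQ_subseq_LIMSEQ [OF Q r])
    then show "(Sn \<circ> r) \<longlonglongrightarrow> L ** Q ** L"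
      by (simp add: ot_map_push Qn_pd Sn o_def)
  qed
  ultimately show "L = ot_map Q S"
    using ot_map_unique [OF Qpd] by metis
qed

lemma continuous_on_ot_map:
  assumes "Q \<in> pos_def"
  shows "continuous_on pos_semidef (ot_map Q)"
proof -
  obtain \<delta> where "0 < \<delta>" "Q - \<delta> *\<^sub>R mat 1 \<in> pos_semidef" using pos_def_lower_bound assms .
  then show ?thesis
    unfolding continuous_on_sequentially o_def by (auto intro!: ot_map_tendsto [where \<delta> = \<delta>])
qed

lemma continuous_on_psd_sqrt: "continuous_on pos_semidef psd_sqrt"
  by (rule continuous_on_eq [OF continuous_on_ot_map [OF pos_def_mat_1] ot_map_id])

section \<open>Convexity of the Bures-Wasserstein distance\<close>

text \<open>The (unsquared) fidelity of quantum information theory.\<close>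
definition fidelity :: "complex^'d^'d \<Rightarrow> complex^'d^'d \<Rightarrow> real" where
  "fidelity Q S = re_trace (psd_sqrt (psd_sqrt Q ** S ** psd_sqrt Q))"

lemma bw_dist_sq_fidelity: "bw_dist_sq Q S = re_trace Q + re_trace S - 2 * fidelity Q S"
  by (simp add: bw_dist_sq_def fidelity_def)

lemma continuous_on_fidelity:
  shows continuous_on_fidelity_left:
      "S \<in> pos_semidef \<Longrightarrow> continuous_on pos_semidef (\<lambda>Q. fidelity Q S)"
    and continuous_on_fidelity_right:
      "Q \<in> pos_semidef \<Longrightarrow> continuous_on pos_semidef (fidelity Q)"
  unfolding fidelity_def re_trace_inner
  by (auto simp del: inner_mat_1 intro!: continuous_intros mm.continuous_on continuous_on_psd_sqrt
      continuous_on_compose2 [OF continuous_on_psd_sqrt] psd_sandwich psd_sqrt_psd)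

lemma continuous_on_bw_dist_sq:
  shows continuous_on_bw_dist_sq_left:
      "S \<in> pos_semidef \<Longrightarrow> continuous_on pos_semidef (\<lambda>Q. bw_dist_sq Q S)"
    and continuous_on_bw_dist_sq_right:
      "Q \<in> pos_semidef \<Longrightarrow> continuous_on pos_semidef (bw_dist_sq Q)"
  unfolding bw_dist_sq_fidelity re_trace_inner
  by (intro continuous_intros continuous_on_fidelity; assumption)+

lemma fidelity_nonneg: "Q \<in> pos_semidef \<Longrightarrow> S \<in> pos_semidef \<Longrightarrow> 0 \<le> fidelity Q S"
  by (simp add: fidelity_def re_trace_psd_nonneg psd_sandwich psd_sqrt_psd)

lemma fidelity_push:
  assumes "Q \<in> pos_semidef" "T \<in> pos_semidef"
  shows "fidelity Q (T ** Q ** T) = T \<bullet> Q"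
proof -
  let ?R = "psd_sqrt Q"
  have "fidelity Q (T ** Q ** T) = mat 1 \<bullet> (?R ** T ** ?R)"
    by (simp add: fidelity_def psd_sqrt_sandwich assms)
  also have "\<dots> = (?R ** T ** ?R) \<bullet> mat 1" by (rule inner_commute)
  also have "\<dots> = (?R ** T) \<bullet> ?R"
    by (simp only: inner_mult_right [of _ ?R] matrix_mul_lid psd_hermitian psd_sqrt_psd assms)
  also have "\<dots> = T \<bullet> (?R ** ?R)"
    by (simp only: inner_mult_left psd_hermitian psd_sqrt_psd assms)
  finally show ?thesis by (simp add: psd_sqrt_mult assms)
qed

lemma fidelity_ot_map:
  "Q \<in> pos_def \<Longrightarrow> S \<in> pos_semidef \<Longrightarrow> fidelity Q S = ot_map Q S \<bullet> Q"
  using fidelity_push [of Q "ot_map Q S"] by (simp add: ot_map_psd ot_map_push pos_def_imp_psd)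

text \<open>The square that is completed in the duality
\<open>2 fidelity Q S = inf {tr (X Q) + tr (X\<^sup>-\<^sup>1 S) | X > 0}\<close>: with \<open>T\<close> the transport map, the excess of \<open>X\<close>
over the infimum is \<open>tr (X\<^sup>-\<^sup>1 (X - T) Q (X - T))\<close>, which vanishes at \<open>X = T\<close>.\<close>
lemma fidelity_gap:
  assumes Q: "Q \<in> pos_def" and S: "S \<in> pos_semidef"
    and X: "X \<in> pos_def" and Y: "Y \<in> pos_def" and XY: "X ** Y = mat 1"
  shows "X \<bullet> Q + Y \<bullet> S - 2 * fidelity Q S
       = Y \<bullet> ((X - ot_map Q S) ** Q ** (X - ot_map Q S))"
proof -
  define T where "T = ot_map Q S"
  have T: "T \<in> pos_semidef" "T ** Q ** T = S"
    unfolding T_def using Q S by (rule ot_map_psd, rule ot_map_push)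
  have YX: "Y ** X = mat 1" using XY by (metis matrix_left_right_inverse)
  have h: "X\<^sup>\<dagger> = X" "Y\<^sup>\<dagger> = Y" "T\<^sup>\<dagger> = T" "Q\<^sup>\<dagger> = Q"
    using Q X Y T(1) by (simp_all add: pos_def_hermitian psd_hermitian)
  have l: "Y \<bullet> (X ** Z) = mat 1 \<bullet> Z" for Z
    using inner_mult_left [of X Y Z] XY h by simp
  have r: "Y \<bullet> (Z ** X) = mat 1 \<bullet> Z" for Z
    using inner_mult_right [of Y X Z] YX h by simp
  have tr: "mat 1 \<bullet> (Z ** Q) = Z \<bullet> Q" if "Z\<^sup>\<dagger> = Z" for Z
    using inner_mult_left [of Z "mat 1" Q] that by simp
  have "mat 1 \<bullet> (Q ** Z) = mat 1 \<bullet> (Z ** Q)" for Z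
    using trace_mul_sym [of Q Z] by simp
  note tr' = this [THEN trans, OF tr]
  have "Y \<bullet> ((X - T) ** Q ** (X - T))
      = Y \<bullet> (X ** (Q ** X)) - Y \<bullet> (X ** (Q ** T)) - Y \<bullet> (T ** Q ** X) + Y \<bullet> S"
    by (simp add: mm.diff_left mm.diff_right inner_diff_right T(2) flip: matrix_mul_assoc)
       (simp add: T(2) matrix_mul_assoc)
  also have "\<dots> = X \<bullet> Q - T \<bullet> Q - T \<bullet> Q + Y \<bullet> S"
    by (simp only: l r tr tr' h)
  finally show ?thesis
    using Q S by (simp add: fidelity_ot_map T_def)
qed

text \<open>For singular \<open>Q\<close> there need not be a transport map, so this case is a limit of \<open>Q + I / (n + 1)\<close>.\<close>
lemma fidelity_le:
  assumes Q: "Q \<in> pos_semidef" and S: "S \<in> pos_semidef"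
    and X: "X \<in> pos_def" and Y: "Y \<in> pos_def" and XY: "X ** Y = mat 1"
  shows "2 * fidelity Q S \<le> X \<bullet> Q + Y \<bullet> S"
proof -
  have pd: "2 * fidelity Q S \<le> X \<bullet> Q + Y \<bullet> S" if Q: "Q \<in> pos_def" for Q
  proof -
    have "(X - ot_map Q S)\<^sup>\<dagger> = X - ot_map Q S"
      using X ot_map_psd [OF Q S] by (simp add: pos_def_hermitian psd_hermitian)
    then have "(X - ot_map Q S) ** Q ** (X - ot_map Q S) \<in> pos_semidef"
      using psd_congruence [OF pos_def_imp_psd [OF Q], of "X - ot_map Q S"] by simp
    then show ?thesis
      using fidelity_gap [OF Q S X Y XY] inner_psd_nonneg [OF pos_def_imp_psd [OF Y]] by smt
  qed
  define Qn where "Qn n = Q + (1 / real (Suc n)) *\<^sub>R mat 1" for n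
  have Qn: "Qn n \<in> pos_def" for n
    unfolding Qn_def using pos_def_add [OF pos_def_scaleR [OF _ pos_def_mat_1] Q]
    by (simp add: add.commute)
  have "Qn \<longlonglongrightarrow> Q + 0 *\<^sub>R mat 1"
    unfolding Qn_def by (intro tendsto_intros LIMSEQ_Suc [OF lim_1_over_n])
  then have lim: "Qn \<longlonglongrightarrow> Q" by simp
  have "(\<lambda>n. 2 * fidelity (Qn n) S) \<longlonglongrightarrow> 2 * fidelity Q S"
    using continuous_on_fidelity_left [OF S] lim Q Qn
    unfolding continuous_on_sequentially o_def by (intro tendsto_intros) (auto simp: pos_def_imp_psd)
  moreover have "(\<lambda>n. X \<bullet> Qn n + Y \<bullet> S) \<longlonglongrightarrow> X \<bullet> Q + Y \<bullet> S"
    by (intro tendsto_intros lim)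
  ultimately show ?thesis
    by (rule LIMSEQ_le) (auto intro!: pd Qn)
qed

text \<open>The gradient of the squared distance at \<open>Q0\<close> is \<open>I - T\<close>: the bound \<open>fidelity_le\<close> with
\<open>X = T = ot_map Q0 S\<close> is affine in \<open>Q\<close> and is attained at \<open>Q = Q0\<close>. It is attained at a further
\<open>Q > 0\<close> only if \<open>T\<close> is the transport map from \<open>Q\<close> too; then \<open>T Q T = S = T Q0 T\<close>, so \<open>Q = Q0\<close>.\<close>
lemma
  assumes Q0: "Q0 \<in> pos_def" and S: "S \<in> pos_def"
  shows bw_dist_sq_subgradient: "Q \<in> pos_semidef \<Longrightarrow>
      bw_dist_sq Q0 S + (mat 1 - ot_map Q0 S) \<bullet> (Q - Q0) \<le> bw_dist_sq Q S"
    and bw_dist_sq_subgradient_strict: "Q \<in> pos_def \<Longrightarrow> Q \<noteq> Q0 \<Longrightarrow>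
      bw_dist_sq Q0 S + (mat 1 - ot_map Q0 S) \<bullet> (Q - Q0) < bw_dist_sq Q S"
proof -
  note Ss = pos_def_imp_psd [OF S]
  define T where "T = ot_map Q0 S"
  have T: "T \<in> pos_def" unfolding T_def using Q0 S by (rule ot_map_pos_def)
  have push: "T ** Q0 ** T = S" unfolding T_def using Q0 Ss by (rule ot_map_push)
  obtain Y where Y: "Y \<in> pos_def" "T ** Y = mat 1" "Y ** T = mat 1" using pos_def_inverse T .
  have YS: "Y \<bullet> S = T \<bullet> Q0"
  proof -
    have "Y \<bullet> S = Y \<bullet> (T ** (Q0 ** T))" by (simp add: push matrix_mul_assoc)
    also have "\<dots> = (T ** Y) \<bullet> (Q0 ** T)"
      using T by (simp only: inner_mult_left pos_def_hermitian)
    also have "\<dots> = (Q0 ** T) \<bullet> mat 1" unfolding Y(2) by (rule inner_commute)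
    also have "\<dots> = T \<bullet> Q0"
      using Q0 by (simp only: inner_mult_left pos_def_hermitian matrix_mul_rid)
    finally show ?thesis .
  qed
  have eq: "bw_dist_sq Q S - (bw_dist_sq Q0 S + (mat 1 - T) \<bullet> (Q - Q0))
      = T \<bullet> Q + Y \<bullet> S - 2 * fidelity Q S" for Q
    using Q0 Ss YS
    by (simp add: bw_dist_sq_fidelity fidelity_ot_map T_def inner_diff_left inner_diff_right)
  { assume "Q \<in> pos_semidef"
    then show "bw_dist_sq Q0 S + (mat 1 - ot_map Q0 S) \<bullet> (Q - Q0) \<le> bw_dist_sq Q S"
      using fidelity_le [OF _ Ss T Y(1,2), of Q] eq [of Q] by (simp add: T_def) }
  assume Q: "Q \<in> pos_def" and ne: "Q \<noteq> Q0"
  define D where "D = T - ot_map Q S"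
  have Dh: "D\<^sup>\<dagger> = D"
    using T ot_map_psd [OF Q Ss] by (simp add: D_def pos_def_hermitian psd_hermitian)
  have DQD: "D ** Q ** D \<in> pos_semidef"
    using psd_congruence [OF pos_def_imp_psd [OF Q], of D] by (simp add: Dh)
  have "Y \<bullet> (D ** Q ** D) \<noteq> 0"
  proof
    assume "Y \<bullet> (D ** Q ** D) = 0"
    then have "D ** Q ** D = 0" using pos_def_inner_eq_0 Y(1) DQD by blast
    moreover have "(D *v x) \<bullet> (Q *v (D *v x)) = x \<bullet> ((D ** Q ** D) *v x)" for x
      by (simp add: inner_matrix_vector [of x D] Dh flip: matrix_vector_mul_assoc)
    ultimately have "(D *v x) \<bullet> (Q *v (D *v x)) = 0" for x by simp
    then have "D *v x = 0" for x using Q unfolding pos_def_iff by (metis less_irrefl)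
    then have "D = 0" by (metis matrix_eq matrix_vector_mult_0)
    then have "T ** Q ** T = T ** Q0 ** T"
      using ot_map_push [OF Q Ss] push by (simp add: D_def)
    then have "(Y ** T) ** Q ** (T ** Y) = (Y ** T) ** Q0 ** (T ** Y)"
      by (metis matrix_mul_assoc)
    then show False using ne by (simp add: Y)
  qed
  moreover have "0 \<le> Y \<bullet> (D ** Q ** D)"
    using inner_psd_nonneg [OF pos_def_imp_psd [OF Y(1)] DQD] .
  ultimately show "bw_dist_sq Q0 S + (mat 1 - ot_map Q0 S) \<bullet> (Q - Q0) < bw_dist_sq Q S"
    using fidelity_gap [OF Q Ss T Y(1,2)] eq [of Q] by (simp add: T_def D_def)
qed

text \<open>The last two bounds are \<open>fidelity_le\<close> with \<open>X = I\<close> and with \<open>X = I/2\<close>.\<close>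
lemma
  assumes Q: "Q \<in> pos_semidef" and S: "S \<in> pos_semidef"
  shows bw_dist_sq_le: "bw_dist_sq Q S \<le> re_trace Q + re_trace S"
    and bw_dist_sq_nonneg: "0 \<le> bw_dist_sq Q S"
    and bw_dist_sq_coercive: "re_trace Q / 2 - re_trace S \<le> bw_dist_sq Q S"
proof -
  show "bw_dist_sq Q S \<le> re_trace Q + re_trace S"
    using fidelity_nonneg [OF Q S] by (simp add: bw_dist_sq_fidelity)
  show "0 \<le> bw_dist_sq Q S"
    using fidelity_le [OF Q S pos_def_mat_1 pos_def_mat_1] by (simp add: bw_dist_sq_fidelity)
  have "2 * fidelity Q S \<le> ((1/2) *\<^sub>R mat 1) \<bullet> Q + (2 *\<^sub>R mat 1) \<bullet> S"
    by (intro fidelity_le Q S pos_def_scaleR pos_def_mat_1)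
       (simp_all add: mm.scaleR_left mm.scaleR_right)
  then show "re_trace Q / 2 - re_trace S \<le> bw_dist_sq Q S"
    by (simp add: bw_dist_sq_fidelity)
qed

lemma bw_dist_sq_lipschitz:
  assumes \<delta>: "0 < \<delta>" and S: "S \<in> pos_def"
    and Q: "Q - \<delta> *\<^sub>R mat 1 \<in> pos_semidef" and Q': "Q' - \<delta> *\<^sub>R mat 1 \<in> pos_semidef"
  shows "bw_dist_sq Q S - bw_dist_sq Q' S
      \<le> (norm (mat 1 :: complex^'d^'d) + sqrt (re_trace S / \<delta>)) * norm (Q - (Q' :: complex^'d^'d))"
proof -
  have Qp: "Q \<in> pos_def" "Q' \<in> pos_def" using pos_def_of_lower_bound \<delta> Q Q' by blast+
  have "bw_dist_sq Q S - bw_dist_sq Q' S \<le> (mat 1 - ot_map Q S) \<bullet> (Q - Q')"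
    using bw_dist_sq_subgradient [OF Qp(1) S, of Q'] Qp(2)
    by (simp add: pos_def_imp_psd inner_diff_right)
  also have "\<dots> \<le> norm (mat 1 - ot_map Q S) * norm (Q - Q')" by (rule norm_cauchy_schwarz)
  also have "\<dots> \<le> (norm (mat 1 :: complex^'d^'d) + sqrt (re_trace S / \<delta>)) * norm (Q - Q')"
    using norm_ot_map_le [OF \<delta> Q pos_def_imp_psd [OF S]]
    by (intro mult_right_mono order_trans [OF norm_triangle_ineq4] add_left_mono) simp_all
  finally show ?thesis .
qed

lemma psd_minimizerD: "psd_minimizer A F Q \<Longrightarrow> Q \<in> pos_semidef \<inter> A"
  "psd_minimizer A F Q \<Longrightarrow> Q' \<in> pos_semidef \<inter> A \<Longrightarrow> F Q \<le> F Q'"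
  by (auto simp: psd_minimizer_def is_arg_min_def not_less)

lemma psd_min_value_eq: "psd_minimizer A F Q \<Longrightarrow> psd_min_value A F = F Q"
  unfolding psd_min_value_def by (rule cInf_eq_minimum) (auto dest: psd_minimizerD)

text \<open>On the cone \<open>\<parallel>Q\<parallel> \<le> tr Q\<close>, so a function that grows at least linearly in the trace has compact
sublevel sets.\<close>
lemma psd_minimizer_exists:
  assumes "closed A" "pos_semidef \<inter> A \<noteq> {}" "continuous_on pos_semidef F" "0 < c"
    and coercive: "\<And>Q. Q \<in> pos_semidef \<Longrightarrow> c * re_trace Q - b \<le> F Q"
  shows "\<exists>Q. psd_minimizer A F Q"
proof -
  obtain Q0 where Q0: "Q0 \<in> pos_semidef \<inter> A" using assms(2) by blast
  define K where "K = pos_semidef \<inter> A \<inter> cball 0 ((F Q0 + b) / c)"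
  have large: "F Q0 < F Q" if "Q \<in> pos_semidef" "(F Q0 + b) / c < norm Q" for Q
  proof -
    have "F Q0 + b < c * norm Q" using that(2) \<open>0 < c\<close> by (simp add: pos_divide_less_eq mult.commute)
    also have "\<dots> \<le> c * re_trace Q" using norm_psd_le_trace [OF that(1)] \<open>0 < c\<close> by simp
    finally show ?thesis using coercive [OF that(1)] by simp
  qed
  have "Q0 \<in> K" using Q0 large [of Q0] by (force simp: K_def)
  moreover have "compact K"
    unfolding K_def by (intro closed_Int_compact closed_Int closed_psd assms compact_cball)
  moreover have "continuous_on K F"
    by (rule continuous_on_subset [OF assms(3)]) (auto simp: K_def)
  ultimately obtain Q where Q: "Q \<in> K" and min: "\<And>Q'. Q' \<in> K \<Longrightarrow> F Q \<le> F Q'"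
    using continuous_attains_inf [of K F] by blast
  have "F Q \<le> F Q'" if "Q' \<in> pos_semidef \<inter> A" for Q'
  proof (cases "Q' \<in> K")
    case False
    then have "F Q0 < F Q'" using that by (intro large) (auto simp: K_def)
    then show ?thesis using min [OF \<open>Q0 \<in> K\<close>] by simp
  qed (rule min)
  then show ?thesis
    using Q by (auto simp: psd_minimizer_def is_arg_min_def not_less K_def intro!: exI [of _ Q])
qed

text \<open>At positive definite points convexity follows from the subgradient inequality at the intermediate
point. Subgradients may fail to exist on the boundary, which is reached by the limit
\<open>z + I / (n + 1) \<rightarrow> z\<close>.\<close>
lemma convex_on_bw_dist_sq:
  fixes S :: "complex^'d^'d"
  assumes S: "S \<in> pos_def"
  shows "convex_on pos_semidef (\<lambda>Q. bw_dist_sq Q S)"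
proof -
  note Ss = pos_def_imp_psd [OF S]
  have pd: "bw_dist_sq (u *\<^sub>R x + w *\<^sub>R y) S \<le> u * bw_dist_sq x S + w * bw_dist_sq y S"
    if x: "x \<in> pos_def" and y: "y \<in> pos_def" and uw: "0 \<le> u" "0 \<le> w" "u + w = 1" for x y u w
  proof -
    let ?z = "u *\<^sub>R x + w *\<^sub>R y"
    have z: "?z \<in> pos_def"
    proof (cases "u = 0")
      case False
      then show ?thesis
        using uw by (intro pos_def_add pos_def_scaleR psd_scaleR pos_def_imp_psd x y) auto
    qed (use uw y in auto)
    let ?g = "mat 1 - ot_map ?z S"
    have "u * (bw_dist_sq ?z S + ?g \<bullet> (x - ?z)) + w * (bw_dist_sq ?z S + ?g \<bullet> (y - ?z))
        \<le> u * bw_dist_sq x S + w * bw_dist_sq y S"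
      using uw x y by (intro add_mono mult_left_mono bw_dist_sq_subgradient [OF z S]) (auto simp: pos_def_imp_psd)
    moreover have "u * (bw_dist_sq ?z S + ?g \<bullet> (x - ?z)) + w * (bw_dist_sq ?z S + ?g \<bullet> (y - ?z))
        = (u + w) * (bw_dist_sq ?z S) + ?g \<bullet> (u *\<^sub>R x + w *\<^sub>R y - (u + w) *\<^sub>R ?z)"
      by (simp only: distrib_left distrib_right inner_diff_right inner_add_right inner_scaleR_right
          right_diff_distrib left_diff_distrib scaleR_add_left)
    ultimately show ?thesis using uw by simp
  qed
  show ?thesis
    unfolding convex_on_def
  proof (intro conjI convex_psd ballI allI impI)
    fix x y :: "complex^'d^'d" and u w :: real
    assume x: "x \<in> pos_semidef" and y: "y \<in> pos_semidef" and uw: "0 \<le> u" "0 \<le> w" "u + w = 1"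
    define p where "p z n = z + (1 / real (Suc n)) *\<^sub>R (mat 1 :: complex^'d^'d)" for z n
    have p: "p z n \<in> pos_def" if "z \<in> pos_semidef" for z n
      using pos_def_add [OF pos_def_scaleR [OF _ pos_def_mat_1] that]
      by (simp add: p_def add.commute)
    have "p z \<longlonglongrightarrow> z + 0 *\<^sub>R mat 1" for z
      unfolding p_def by (intro tendsto_intros LIMSEQ_Suc [OF lim_1_over_n])
    then have lim: "p z \<longlonglongrightarrow> z" for z by simp
    have lim_bw: "(\<lambda>n. bw_dist_sq (q n) S) \<longlonglongrightarrow> bw_dist_sq z S"
      if "q \<longlonglongrightarrow> z" "\<And>n. q n \<in> pos_semidef" "z \<in> pos_semidef" for q z
      using continuous_on_bw_dist_sq_left [OF Ss] that unfolding continuous_on_sequentially o_def by blast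
    show "bw_dist_sq (u *\<^sub>R x + w *\<^sub>R y) S \<le> u * bw_dist_sq x S + w * bw_dist_sq y S"
    proof (rule LIMSEQ_le)
      show "(\<lambda>n. bw_dist_sq (u *\<^sub>R p x n + w *\<^sub>R p y n) S) \<longlonglongrightarrow> bw_dist_sq (u *\<^sub>R x + w *\<^sub>R y) S"
        using uw x y
        by (intro lim_bw tendsto_intros lim) (auto intro!: psd_add psd_scaleR pos_def_imp_psd [OF p])
      show "(\<lambda>n. u * bw_dist_sq (p x n) S + w * bw_dist_sq (p y n) S)
          \<longlonglongrightarrow> u * bw_dist_sq x S + w * bw_dist_sq y S"
        using x y by (intro tendsto_intros lim_bw lim pos_def_imp_psd [OF p])
      show "\<exists>N. \<forall>n\<ge>N. bw_dist_sq (u *\<^sub>R p x n + w *\<^sub>R p y n) S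
          \<le> u * bw_dist_sq (p x n) S + w * bw_dist_sq (p y n) S"
        using uw x y by (auto intro!: pd p)
    qed
  qed
qed

section \<open>Minimizers of the expected distance\<close>

lemma trace_linear [simp]:
  "trace (A + B) = trace A + trace (B :: complex^'d^'d)"
  "trace (A - B) = trace A - trace (B :: complex^'d^'d)"
  "trace (c *\<^sub>R A) = c *\<^sub>R trace (A :: complex^'d^'d)"
  by (simp_all add: trace_def sum.distrib sum_subtractf scaleR_sum_right)

text \<open>The gradient explodes at the boundary of the cone. If \<open>Q v = 0\<close> then \<open>R = (1 - t) Q + t Q1\<close> has
\<open>v\<^sup>\<dagger> R v = t (v\<^sup>\<dagger> Q1 v)\<close>. The transport map \<open>T\<close> has to stretch this small value to one of order
\<open>s\<close>: \<open>u = T\<^sup>-\<^sup>1 v\<close> satisfies \<open>s \<parallel>u\<parallel>\<^sup>2 \<le> u\<^sup>\<dagger> S u = v\<^sup>\<dagger> R v\<close>, and by Cauchy-Schwarz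
\<open>1 = (v\<^sup>\<dagger> T u)\<^sup>2 \<le> (v\<^sup>\<dagger> T v) \<parallel>u\<parallel>\<close>. Hence \<open>v\<^sup>\<dagger> T v\<close> is at least of order \<open>t\<^sup>-\<^sup>1\<^sup>/\<^sup>2\<close>.\<close>
lemma ot_map_blowup:
  fixes Q Q1 S :: "complex^'d^'d"
  assumes v: "norm v = 1" and Qv: "Q *v v = 0"
    and \<delta>: "0 < \<delta>" "Q1 - \<delta> *\<^sub>R mat 1 \<in> pos_semidef"
    and s: "0 < s" "S - s *\<^sub>R mat 1 \<in> pos_semidef" and S: "S \<in> pos_def"
    and t: "0 < t" and Qt: "(1 - t) *\<^sub>R Q + t *\<^sub>R Q1 \<in> pos_def"
  shows "\<delta> * sqrt (s / (t * (v \<bullet> (Q1 *v v)))) \<le> ot_map ((1 - t) *\<^sub>R Q + t *\<^sub>R Q1) S \<bullet> Q1"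
proof -
  define R where "R = (1 - t) *\<^sub>R Q + t *\<^sub>R Q1"
  have R: "R \<in> pos_def" using Qt by (simp add: R_def)
  define T where "T = ot_map R S"
  have T: "T \<in> pos_def" unfolding T_def using R S by (rule ot_map_pos_def)
  note Ts = pos_def_imp_psd [OF T]
  have push: "T ** R ** T = S" unfolding T_def using R pos_def_imp_psd [OF S] by (rule ot_map_push)
  obtain Y where Y: "T ** Y = mat 1" using pos_def_inverse T .
  define u where "u = Y *v v"
  have Tu: "T *v u = v" by (simp add: u_def matrix_vector_mul_assoc Y)
  let ?c = "v \<bullet> (Q1 *v v)"
  have "t * ?c = v \<bullet> (R *v v)"
    by (simp add: R_def mv.add_left mv.scaleR_left Qv)
  also have "\<dots> = u \<bullet> (S *v u)"
    by (simp add: push [symmetric] Tu inner_matrix_vector [of u T] pos_def_hermitian [OF T]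
        flip: matrix_vector_mul_assoc)
  also have "s * (norm u)\<^sup>2 \<le> u \<bullet> (S *v u)"
    using s(2) by (simp add: psd_iff mv.diff_left mv.scaleR_left inner_diff_right power2_norm_eq_inner)
  finally have u: "s * (norm u)\<^sup>2 \<le> t * ?c" by simp
  have "u \<noteq> 0" using Tu v by auto
  have c: "0 < t * ?c"
    using u s(1) \<open>u \<noteq> 0\<close> by (meson less_le_trans mult_pos_pos zero_less_norm_iff zero_less_power)
  define B where "B = psd_sqrt T"
  have B: "B\<^sup>\<dagger> = B" "B ** B = T"
    by (simp_all add: B_def psd_hermitian psd_sqrt_psd psd_sqrt_mult Ts)
  have form: "x \<bullet> (T *v y) = (B *v x) \<bullet> (B *v y)" for x y
    by (simp add: B(2) [symmetric] inner_matrix_vector [of x B] B(1) flip: matrix_vector_mul_assoc)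
  have "1 = v \<bullet> (T *v u)" using v by (simp add: Tu flip: power2_norm_eq_inner)
  then have "1 = ((B *v v) \<bullet> (B *v u))\<^sup>2" by (simp add: form)
  also have "\<dots> \<le> (v \<bullet> (T *v v)) * (u \<bullet> (T *v u))"
    unfolding form by (rule Cauchy_Schwarz_ineq)
  also have "u \<bullet> (T *v u) \<le> norm u" using norm_cauchy_schwarz [of u v] v by (simp add: Tu)
  finally have 1: "1 \<le> (v \<bullet> (T *v v)) * norm u"
    using Ts by (simp add: mult_left_mono psd_iff)
  have "(norm u)\<^sup>2 \<le> t * ?c / s" using u s(1) by (simp add: field_simps)
  then have "norm u \<le> sqrt (t * ?c / s)" by (rule real_le_rsqrt)
  then have "1 \<le> (v \<bullet> (T *v v)) * sqrt (t * ?c / s)"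
    using 1 Ts by (meson mult_left_mono order_trans psd_iff)
  then have "sqrt (s / (t * ?c)) \<le> v \<bullet> (T *v v)"
    using c s(1) by (simp add: real_sqrt_divide field_simps)
  also have "\<dots> \<le> re_trace T"
    using psd_le_trace [OF Ts] v
    by (simp add: psd_iff mv.diff_left mv.scaleR_left inner_diff_right flip: power2_norm_eq_inner)
       (metis (no_types, lifting) mult.right_neutral one_power2)
  finally have "\<delta> * sqrt (s / (t * ?c)) \<le> \<delta> * re_trace T" using \<delta>(1) by simp
  also have "\<dots> \<le> T \<bullet> Q1"
    using inner_mono [OF Ts \<delta>(2)] by simp
  finally show ?thesis by (simp add: T_def R_def)
qed

lemma ot_map_inner_le:
  assumes "Q \<in> pos_def" "S \<in> pos_semidef"
  shows "2 * (ot_map Q S \<bullet> Q) \<le> re_trace Q + re_trace S"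
  using bw_dist_sq_nonneg [of Q S] assms
  by (simp add: bw_dist_sq_fidelity fidelity_ot_map pos_def_imp_psd)

text \<open>The subgradient inequality at \<open>R = (1 - t) Q + t Q1\<close>, with \<open>tr (T Q)\<close> bounded by means of
\<open>(1 - t) tr (T Q) \<le> tr (T R) = fidelity R S\<close>. Moving from \<open>Q\<close> towards \<open>Q1\<close> thus costs \<open>O(t)\<close> and gains
\<open>t tr (T Q1)\<close>, which \<open>ot_map_blowup\<close> shows to be of order \<open>t\<^sup>1\<^sup>/\<^sup>2\<close> when \<open>Q\<close> is singular.\<close>
lemma bw_dist_sq_step_le:
  fixes Q Q1 S :: "complex^'d^'d"
  assumes Q: "Q \<in> pos_semidef" and Q1: "Q1 \<in> pos_semidef" and S: "S \<in> pos_def"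
    and t: "0 < t" "t \<le> 1 / 2" and Qt: "(1 - t) *\<^sub>R Q + t *\<^sub>R Q1 \<in> pos_def"
  shows "bw_dist_sq ((1 - t) *\<^sub>R Q + t *\<^sub>R Q1) S
    \<le> bw_dist_sq Q S + t * (2 * re_trace Q1 + re_trace S)
      - t * (ot_map ((1 - t) *\<^sub>R Q + t *\<^sub>R Q1) S \<bullet> Q1)"
proof -
  define R where "R = (1 - t) *\<^sub>R Q + t *\<^sub>R Q1"
  have R: "R \<in> pos_def" using Qt by (simp add: R_def)
  define T where "T = ot_map R S"
  have T: "T \<in> pos_semidef" unfolding T_def using R pos_def_imp_psd [OF S] by (rule ot_map_psd)
  have QR: "Q - R = - (t *\<^sub>R (Q1 - Q))" by (simp add: R_def algebra_simps)
  have trR: "re_trace R = (1 - t) * re_trace Q + t * re_trace Q1" by (simp add: R_def)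
  have "(1 - t) * (T \<bullet> Q) \<le> T \<bullet> R"
    using t inner_psd_nonneg [OF T Q1] by (simp add: R_def inner_add_right)
  moreover have "(1 / 2) * (T \<bullet> Q) \<le> (1 - t) * (T \<bullet> Q)"
    using t inner_psd_nonneg [OF T Q] by (intro mult_right_mono) auto
  ultimately have "T \<bullet> Q \<le> re_trace R + re_trace S"
    using ot_map_inner_le [OF R pos_def_imp_psd [OF S]] by (simp add: T_def)
  also have "re_trace R \<le> re_trace Q + re_trace Q1"
    using t re_trace_psd_nonneg [OF Q] re_trace_psd_nonneg [OF Q1]
    unfolding trR by (intro add_mono mult_left_le_one_le) auto
  finally have "t * (T \<bullet> Q) \<le> t * (re_trace Q + re_trace Q1 + re_trace S)"
    using t by (intro mult_left_mono) simp_all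
  moreover have "bw_dist_sq R S + (mat 1 - T) \<bullet> (Q - R) \<le> bw_dist_sq Q S"
    unfolding T_def by (rule bw_dist_sq_subgradient [OF R S Q])
  moreover have "(mat 1 - T) \<bullet> (Q - R)
      = - (t * re_trace Q1 - t * re_trace Q - t * (T \<bullet> Q1) + t * (T \<bullet> Q))"
    by (simp add: QR inner_diff_left inner_diff_right algebra_simps)
  ultimately have "bw_dist_sq R S
      \<le> bw_dist_sq Q S + t * (2 * re_trace Q1 + re_trace S) - t * (T \<bullet> Q1)"
    by (simp only: distrib_left)
  then show ?thesis unfolding T_def R_def .
qed

locale bures_wasserstein_model = prob_space P for P :: "(complex^'d^'d) measure" +
  assumes sets_P: "sets P = sets (restrict_space borel pos_semidef)"
    and trace_sq: "integrable P (\<lambda>S. (re_trace S)\<^sup>2)"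
    and prob_pos_def: "prob pos_def = 1"
begin

lemma space_P: "space P = pos_semidef"
  using sets_eq_imp_space_eq [OF sets_P] by (simp add: space_restrict_space)

lemma borel_measurable_continuous:
  "continuous_on pos_semidef \<phi> \<Longrightarrow> \<phi> \<in> borel_measurable P"
  unfolding measurable_cong_sets [OF sets_P refl] by (rule borel_measurable_continuous_on_restrict)

lemma AE_pos_def: "AE S in P. S \<in> pos_def"
  using prob_pos_def by (rule AE_prob_1)

lemma trace_measurable [measurable]: "re_trace \<in> borel_measurable P"
  unfolding re_trace_inner by (intro borel_measurable_continuous continuous_intros)

lemma trace_integrable: "integrable P re_trace"
  by (rule square_integrable_imp_integrable [OF trace_measurable trace_sq])

lemma bw_measurable: "Q \<in> pos_semidef \<Longrightarrow> bw_dist_sq Q \<in> borel_measurable P"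
  by (intro borel_measurable_continuous continuous_on_bw_dist_sq_right)

lemma affine_trace_sq_integrable: "integrable P (\<lambda>S. (a + re_trace S)\<^sup>2)"
  unfolding power2_sum using trace_integrable trace_sq by simp

lemma bw_sq_integrable:
  assumes "Q \<in> pos_semidef"
  shows "integrable P (\<lambda>S. (bw_dist_sq Q S)\<^sup>2)"
proof (rule Bochner_Integration.integrable_bound [OF affine_trace_sq_integrable [of "re_trace Q"]])
  show "(\<lambda>S. (bw_dist_sq Q S)\<^sup>2) \<in> borel_measurable P" using bw_measurable [OF assms] by measurable
  show "AE S in P. norm ((bw_dist_sq Q S)\<^sup>2) \<le> norm ((re_trace Q + re_trace S)\<^sup>2)"
    using assms by (intro AE_I2) (auto simp: space_P intro!: power_mono bw_dist_sq_le bw_dist_sq_nonneg)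
qed

lemma bw_integrable: "Q \<in> pos_semidef \<Longrightarrow> integrable P (bw_dist_sq Q)"
  by (rule square_integrable_imp_integrable [OF bw_measurable bw_sq_integrable])

lemma population_obj_coercive:
  assumes "Q \<in> pos_semidef"
  shows "1 / 2 * re_trace Q - (\<integral>S. re_trace S \<partial>P) \<le> population_obj P Q"
proof -
  have "(\<integral>S. re_trace Q / 2 - re_trace S \<partial>P) \<le> (\<integral>S. bw_dist_sq Q S \<partial>P)"
    using assms trace_integrable
    by (intro integral_mono bw_integrable) (auto simp: space_P intro: bw_dist_sq_coercive)
  then show ?thesis
    using trace_integrable by (simp add: population_obj_def prob_space)
qed

lemma continuous_on_population_obj: "continuous_on pos_semidef (population_obj P)"
  unfolding continuous_on_sequentially o_def
proof (intro allI ballI impI)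
  fix x :: "nat \<Rightarrow> complex^'d^'d" and Q
  assume Q: "Q \<in> pos_semidef" and "(\<forall>n. x n \<in> pos_semidef) \<and> x \<longlonglongrightarrow> Q"
  then have x: "\<And>n. x n \<in> pos_semidef" "x \<longlonglongrightarrow> Q" by auto
  have "(\<lambda>n. re_trace (x n)) \<longlonglongrightarrow> re_trace Q"
    unfolding re_trace_inner by (intro tendsto_intros x)
  then have "bounded (range (\<lambda>n. re_trace (x n)))" by (rule convergent_imp_bounded)
  then obtain b where "\<And>n. \<bar>re_trace (x n)\<bar> \<le> b" unfolding bounded_iff by auto
  then have b: "re_trace (x n) \<le> b" for n by (meson abs_le_D1)
  show "(\<lambda>n. population_obj P (x n)) \<longlonglongrightarrow> population_obj P Q"
    unfolding population_obj_def
  proof (rule integral_dominated_convergence [where w = "\<lambda>S. b + re_trace S"])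
    show "AE S in P. (\<lambda>n. bw_dist_sq (x n) S) \<longlonglongrightarrow> bw_dist_sq Q S"
      using continuous_on_bw_dist_sq_left x Q
      by (intro AE_I2) (auto simp: space_P continuous_on_sequentially o_def)
    fix n
    show "AE S in P. norm (bw_dist_sq (x n) S) \<le> b + re_trace S"
    proof (rule AE_I2)
      fix S assume "S \<in> space P"
      then have S: "S \<in> pos_semidef" by (simp add: space_P)
      show "norm (bw_dist_sq (x n) S) \<le> b + re_trace S"
        using bw_dist_sq_le [OF x(1) S, of n] bw_dist_sq_nonneg [OF x(1) S, of n] b [of n] by simp
    qed
  qed (use trace_integrable bw_measurable x Q in auto)
qed

lemma population_minimizer_exists:
  "closed A \<Longrightarrow> pos_semidef \<inter> A \<noteq> {} \<Longrightarrow> \<exists>Q. psd_minimizer A (population_obj P) Q"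
  by (rule psd_minimizer_exists [OF _ _ continuous_on_population_obj _ population_obj_coercive])
     simp_all

text \<open>The lower bound \<open>S \<ge> s I\<close> in \<open>ot_map_blowup\<close> is available only on an event. Almost surely
\<open>S \<ge> I / (k + 1)\<close> for some \<open>k\<close>, so for one of these countably many bounds the event has positive
probability.\<close>
lemma exists_lower_bound_event:
  obtains s where "0 < s" "{S \<in> space P. S - s *\<^sub>R mat 1 \<in> pos_semidef} \<in> events"
    "0 < prob {S \<in> space P. S - s *\<^sub>R mat 1 \<in> pos_semidef}"
proof -
  let ?E = "\<lambda>s. {S \<in> space P. S - s *\<^sub>R mat 1 \<in> pos_semidef}"
  have E [measurable]: "?E s \<in> events" for s
  proof -
    have "(\<lambda>S. S - s *\<^sub>R mat 1) \<in> borel_measurable P"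
      by (intro borel_measurable_continuous continuous_intros)
    from measurable_sets [OF this borel_closed [OF closed_psd]] show ?thesis
      by (simp add: vimage_def Int_def conj_commute)
  qed
  have "\<exists>k. 0 < prob (?E (1 / real (Suc k)))"
  proof (rule ccontr)
    assume "\<not> ?thesis"
    then have "prob (?E (1 / real (Suc k))) = 0" for k by (simp add: not_less measure_le_0_iff)
    then have "AE S in P. S \<notin> ?E (1 / real (Suc k))" for k
      using E by (simp add: AE_iff_measurable [OF E] emeasure_eq_measure)
    then have "AE S in P. \<forall>k. S \<notin> ?E (1 / real (Suc k))" by (simp only: AE_all_countable) blast
    then have "AE S in P. False"
      using AE_pos_def AE_space
    proof eventually_elim
      case (elim S)
      obtain \<delta> where \<delta>: "0 < \<delta>" "S - \<delta> *\<^sub>R mat 1 \<in> pos_semidef"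
        using pos_def_lower_bound elim(2) .
      obtain k where "1 / real (Suc k) < \<delta>" using \<delta>(1) nat_approx_posE by metis
      then have "(S - \<delta> *\<^sub>R mat 1) + (\<delta> - 1 / real (Suc k)) *\<^sub>R mat 1 \<in> pos_semidef"
        by (intro psd_add psd_scaleR \<delta> pos_def_imp_psd pos_def_mat_1) simp
      then have "S - (1 / real (Suc k)) *\<^sub>R mat 1 \<in> pos_semidef"
        by (simp add: scaleR_diff_left)
      then show False using elim by blast
    qed
    then show False by simp
  qed
  then obtain k where "0 < prob (?E (1 / real (Suc k)))" ..
  then show thesis using that [of "1 / real (Suc k)"] E by simp
qed

text \<open>From a singular \<open>Q\<close>, a short step \<open>t\<close> towards a positive definite point of \<open>A\<close> changes the objective by at
most \<open>t b - t\<^sup>1\<^sup>/\<^sup>2 \<kappa>\<close> with \<open>\<kappa> > 0\<close>, which is negative for small \<open>t\<close>.\<close>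
lemma minimizer_pos_def:
  assumes min: "psd_minimizer A (population_obj P) Q" and A: "affine A" and Q1: "Q1 \<in> pos_def \<inter> A"
  shows "Q \<in> pos_def"
proof (rule ccontr)
  assume "Q \<notin> pos_def"
  have Q: "Q \<in> pos_semidef" "Q \<in> A" using psd_minimizerD(1) [OF min] by auto
  have Q1s: "Q1 \<in> pos_semidef" using Q1 by (simp add: pos_def_imp_psd)
  obtain x where "x \<noteq> 0" "Q *v x = 0"
    using psd_imp_pos_def Q(1) \<open>Q \<notin> pos_def\<close> by blast
  define v where "v = x /\<^sub>R norm x"
  have v: "norm v = 1" "Q *v v = 0"
    using \<open>x \<noteq> 0\<close> \<open>Q *v x = 0\<close> by (simp_all add: v_def mv.scaleR_right)
  define c where "c = v \<bullet> (Q1 *v v)"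
  have "v \<noteq> 0" using v by auto
  then have c: "0 < c" using Q1 unfolding c_def by (auto simp: pos_def_iff)
  obtain \<delta> where \<delta>: "0 < \<delta>" "Q1 - \<delta> *\<^sub>R mat 1 \<in> pos_semidef" using pos_def_lower_bound Q1 by blast
  obtain s where s: "0 < s" and E: "{S \<in> space P. S - s *\<^sub>R mat 1 \<in> pos_semidef} \<in> events"
    and pE: "0 < prob {S \<in> space P. S - s *\<^sub>R mat 1 \<in> pos_semidef}"
    using exists_lower_bound_event by blast
  define E where "E = {S \<in> space P. S - s *\<^sub>R mat 1 \<in> pos_semidef}"
  define b where "b = 2 * re_trace Q1 + (\<integral>S. re_trace S \<partial>P)"
  define \<kappa> where "\<kappa> = \<delta> * sqrt (s / c) * prob E"
  have \<kappa>: "0 < \<kappa>" using \<delta> s c pE by (simp add: \<kappa>_def E_def)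
  have b: "0 \<le> b"
    unfolding b_def using re_trace_psd_nonneg [OF Q1s]
    by (intro add_nonneg_nonneg integral_nonneg_AE AE_I2) (auto simp: space_P re_trace_psd_nonneg)
  \<comment> \<open>The step is \<open>t = w\<^sup>2\<close>, chosen such that \<open>w b < \<kappa>\<close>.\<close>
  define w where "w = min (1 / 2) (\<kappa> / (2 * (b + 1)))"
  have w: "0 < w" using \<kappa> b by (simp add: w_def)
  have w_le: "w \<le> 1 / 2" unfolding w_def by (rule min.cobounded1)
  have "w * b \<le> \<kappa> / (2 * (b + 1)) * b" using b by (intro mult_right_mono) (simp_all add: w_def)
  also have "\<dots> < \<kappa>" using b \<kappa> by (simp add: field_simps add_nonneg_pos)
  finally have wb: "w * b < \<kappa>" .
  define t where "t = w\<^sup>2"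
  have "w * w \<le> 1 / 2 * 1" using w w_le by (intro mult_mono) auto
  then have t: "0 < t" "t \<le> 1 / 2" using w by (auto simp: t_def power2_eq_square)
  define R where "R = (1 - t) *\<^sub>R Q + t *\<^sub>R Q1"
  have R: "R \<in> pos_def"
    unfolding R_def using t Q Q1 pos_def_add [of "t *\<^sub>R Q1" "(1 - t) *\<^sub>R Q"]
    by (simp add: pos_def_scaleR psd_scaleR add.commute)
  have "R \<in> A"
    unfolding R_def using A Q Q1 by (simp add: mem_affine)
  have "AE S in P. bw_dist_sq R S
      \<le> bw_dist_sq Q S + t * (2 * re_trace Q1 + re_trace S) - w * (\<delta> * sqrt (s / c)) * indicator E S"
    using AE_pos_def
  proof eventually_elim
    case (elim S)
    have "w * (\<delta> * sqrt (s / c)) * indicator E S \<le> t * (ot_map R S \<bullet> Q1)"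
    proof (cases "S \<in> E")
      case True
      have "\<delta> * sqrt (s / (t * c)) \<le> ot_map R S \<bullet> Q1"
        unfolding R_def c_def using True t R
        by (intro ot_map_blowup v \<delta> s elim) (simp_all add: E_def R_def)
      then have "t * (\<delta> * sqrt (s / (t * c))) \<le> t * (ot_map R S \<bullet> Q1)"
        using t by (intro mult_left_mono) auto
      moreover have "t * (\<delta> * sqrt (s / (t * c))) = w * (\<delta> * sqrt (s / c))"
        using w by (simp add: t_def real_sqrt_divide real_sqrt_mult power2_eq_square)
      ultimately show ?thesis using True by simp
    next
      case False
      have "0 \<le> ot_map R S \<bullet> Q1"
        by (intro inner_psd_nonneg ot_map_psd R Q1s pos_def_imp_psd elim)
      then show ?thesis using False t by simp
    qed
    then show ?case
      using bw_dist_sq_step_le [OF Q(1) Q1s elim t] R by (simp add: R_def)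
  qed
  then have "(\<integral>S. bw_dist_sq R S \<partial>P) \<le> (\<integral>S. bw_dist_sq Q S + t * (2 * re_trace Q1 + re_trace S)
      - w * (\<delta> * sqrt (s / c)) * indicator E S \<partial>P)"
    using E by (intro integral_mono_AE bw_integrable pos_def_imp_psd R Bochner_Integration.integrable_diff
        Bochner_Integration.integrable_add integrable_mult_right Q trace_integrable integrable_real_indicator
        integrable_const) (auto simp: E_def less_top [symmetric])
  also have "\<dots> = (\<integral>S. bw_dist_sq Q S \<partial>P) + t * b - w * (\<delta> * sqrt (s / c)) * prob E"
    using E trace_integrable bw_integrable [OF Q(1)]
    by (simp add: E_def [symmetric] b_def prob_space less_top [symmetric])
  also have "\<dots> = (\<integral>S. bw_dist_sq Q S \<partial>P) + w * (w * b - \<kappa>)"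
    by (simp add: t_def \<kappa>_def power2_eq_square algebra_simps)
  also have "\<dots> < (\<integral>S. bw_dist_sq Q S \<partial>P)"
    using wb w by (simp add: mult_less_0_iff)
  finally have "population_obj P R < population_obj P Q" by (simp add: population_obj_def)
  then show False
    using psd_minimizerD(2) [OF min, of R] R \<open>R \<in> A\<close> by (simp add: pos_def_imp_psd)
qed

text \<open>Both minimizers are positive definite, and almost surely the distance is strictly convex between
them, so that their midpoint would have a smaller expected distance.\<close>
lemma minimizer_unique:
  assumes Q: "psd_minimizer A (population_obj P) Q" and Q': "psd_minimizer A (population_obj P) Q'"
    and A: "affine A" and ne: "pos_def \<inter> A \<noteq> {}"
  shows "Q = Q'"
proof (rule ccontr)
  assume "Q \<noteq> Q'"
  have pd: "Q \<in> pos_def" "Q' \<in> pos_def" using minimizer_pos_def A ne Q Q' by blast+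
  note psd = pd [THEN pos_def_imp_psd]
  have inA: "Q \<in> A" "Q' \<in> A" using psd_minimizerD(1) Q Q' by auto
  define R where "R = (1 / 2) *\<^sub>R Q + (1 / 2) *\<^sub>R Q'"
  have R: "R \<in> pos_def" unfolding R_def by (intro pos_def_add pos_def_scaleR psd_scaleR pd psd) simp_all
  have RA: "R \<in> A" unfolding R_def using A inA by (simp add: mem_affine)
  have "2 *\<^sub>R R = Q + Q'" by (simp add: R_def scaleR_add_right)
  then have "Q \<noteq> R" using \<open>Q \<noteq> Q'\<close> by (auto simp: scaleR_2)
  have opp: "Q' - R = - (Q - R)"
    by (simp add: R_def vec_eq_iff scaleR_conv_of_real [where 'a = complex] field_simps)
  have "AE S in P. 2 * bw_dist_sq R S < bw_dist_sq Q S + bw_dist_sq Q' S"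
    using AE_pos_def
  proof eventually_elim
    case (elim S)
    have "bw_dist_sq R S + (mat 1 - ot_map R S) \<bullet> (Q - R) < bw_dist_sq Q S"
      by (rule bw_dist_sq_subgradient_strict [OF R elim pd(1) \<open>Q \<noteq> R\<close>])
    moreover have "bw_dist_sq R S + (mat 1 - ot_map R S) \<bullet> (Q' - R) \<le> bw_dist_sq Q' S"
      by (rule bw_dist_sq_subgradient [OF R elim psd(2)])
    ultimately show ?case unfolding opp inner_minus_right by linarith
  qed
  then have "(\<integral>S. 2 * bw_dist_sq R S \<partial>P) < (\<integral>S. bw_dist_sq Q S + bw_dist_sq Q' S \<partial>P)"
    using bw_integrable [OF pos_def_imp_psd [OF R]] bw_integrable [OF psd(1)] bw_integrable [OF psd(2)]
    by (intro integral_less_AE_space) (simp_all add: emeasure_space_1)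
  then have "2 * population_obj P R < population_obj P Q + population_obj P Q'"
    using bw_integrable [OF psd(1)] bw_integrable [OF psd(2)] by (simp add: population_obj_def)
  moreover have "population_obj P Q \<le> population_obj P R" "population_obj P Q' \<le> population_obj P R"
    using psd_minimizerD(2) [OF Q, of R] psd_minimizerD(2) [OF Q', of R] R RA
    by (simp_all add: pos_def_imp_psd)
  ultimately show False by simp
qed

lemma ot_map_measurable: "Q \<in> pos_def \<Longrightarrow> ot_map Q \<in> borel_measurable P"
  by (intro borel_measurable_continuous continuous_on_ot_map)

text \<open>The function \<open>a + (tr S / \<delta>)\<^sup>1\<^sup>/\<^sup>2\<close> with \<open>a = \<parallel>I\<parallel>\<close> dominates the gradient at every \<open>Q \<ge> \<delta> I\<close>.\<close>
lemma sqrt_trace_sq_integrable: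
  assumes "0 < \<delta>"
  shows "integrable P (\<lambda>S. (a + sqrt (re_trace S / \<delta>))\<^sup>2)"
proof (rule Bochner_Integration.integrable_bound)
  show "integrable P (\<lambda>S. 2 * a\<^sup>2 + 2 * (re_trace S / \<delta>))"
    using trace_integrable by simp
  show "AE S in P. norm ((a + sqrt (re_trace S / \<delta>))\<^sup>2) \<le> norm (2 * a\<^sup>2 + 2 * (re_trace S / \<delta>))"
  proof (rule AE_I2)
    fix S assume "S \<in> space P"
    then have "0 \<le> re_trace S / \<delta>" using assms by (simp add: space_P re_trace_psd_nonneg)
    moreover have "(a + y)\<^sup>2 \<le> 2 * a\<^sup>2 + 2 * y\<^sup>2" for y
      using zero_le_power2 [of "a - y"] by (simp add: power2_sum power2_diff)
    from this [of "sqrt (re_trace S / \<delta>)"] calculation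
    have "(a + sqrt (re_trace S / \<delta>))\<^sup>2 \<le> 2 * a\<^sup>2 + 2 * (re_trace S / \<delta>)" by simp
    then show "norm ((a + sqrt (re_trace S / \<delta>))\<^sup>2) \<le> norm (2 * a\<^sup>2 + 2 * (re_trace S / \<delta>))"
      by simp
  qed
qed measurable

lemma norm_gradient_le:
  fixes Q S :: "complex^'d^'d"
  assumes "0 < \<delta>" "Q - \<delta> *\<^sub>R mat 1 \<in> pos_semidef" "S \<in> pos_semidef"
  shows "norm (mat 1 - ot_map Q S) \<le> norm (mat 1 :: complex^'d^'d) + sqrt (re_trace S / \<delta>)"
  using norm_triangle_ineq4 [of "mat 1" "ot_map Q S"] norm_ot_map_le [OF assms] by linarith

lemma gradient_sq_integrable:
  assumes "Q \<in> pos_def"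
  shows "integrable P (\<lambda>S. (norm (mat 1 - ot_map Q S))\<^sup>2)"
proof -
  obtain \<delta> where \<delta>: "0 < \<delta>" "Q - \<delta> *\<^sub>R mat 1 \<in> pos_semidef" using pos_def_lower_bound assms .
  show ?thesis
  proof (rule Bochner_Integration.integrable_bound [OF sqrt_trace_sq_integrable [OF \<delta>(1)]])
    show "AE S in P. norm ((norm (mat 1 - ot_map Q S))\<^sup>2)
        \<le> norm ((norm (mat 1 :: complex^'d^'d) + sqrt (re_trace S / \<delta>))\<^sup>2)"
      using norm_gradient_le [OF \<delta>]
      by (intro AE_I2) (simp add: space_P power_mono)
  qed (use ot_map_measurable [OF assms] in measurable)
qed

lemma gradient_integrable:
  assumes "Q \<in> pos_def"
  shows "integrable P (\<lambda>S. mat 1 - ot_map Q S)"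
proof -
  have [measurable]: "ot_map Q \<in> borel_measurable P" using assms by (rule ot_map_measurable)
  have "integrable P (\<lambda>S. norm (mat 1 - ot_map Q S))"
    by (rule square_integrable_imp_integrable [OF _ gradient_sq_integrable [OF assms]]) simp
  then show ?thesis by (subst (asm) integrable_norm_iff) auto
qed

text \<open>Optimality of \<open>Q\<close> against \<open>R = (1 - t) Q + t Q'\<close>, combined with the subgradient inequality at \<open>R\<close>,
bounds the expected gradient at \<open>R\<close> from below in the direction \<open>Q' - Q\<close>. As \<open>t\<close> tends to \<open>0\<close>, the gradient
at \<open>R\<close> converges to the one at \<open>Q\<close>, dominated because \<open>R \<ge> \<delta> I\<close> for all \<open>t \<le> 1/2\<close>.\<close>
lemma minimizer_first_order:
  assumes min: "psd_minimizer A (population_obj P) Q" and A: "affine A" and Q: "Q \<in> pos_def"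
    and Q': "Q' \<in> pos_semidef \<inter> A"
  shows "0 \<le> (\<integral>S. mat 1 - ot_map Q S \<partial>P) \<bullet> (Q' - Q)"
proof -
  note Qs = pos_def_imp_psd [OF Q]
  have QA: "Q \<in> A" using psd_minimizerD(1) [OF min] by simp
  obtain \<delta>2 where \<delta>2: "0 < \<delta>2" "Q - \<delta>2 *\<^sub>R mat 1 \<in> pos_semidef" using pos_def_lower_bound Q .
  define \<delta> where "\<delta> = \<delta>2 / 2"
  have \<delta>: "0 < \<delta>" using \<delta>2 by (simp add: \<delta>_def)
  define t where "t n = 1 / real (n + 2)" for n
  have t: "0 < t n" "t n \<le> 1 / 2" for n by (simp_all add: t_def)
  define R where "R n = (1 - t n) *\<^sub>R Q + t n *\<^sub>R Q'" for n
  have R_lb: "R n - \<delta> *\<^sub>R mat 1 \<in> pos_semidef" for n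
  proof -
    have "R n - \<delta> *\<^sub>R mat 1 = (1 - t n) *\<^sub>R (Q - \<delta>2 *\<^sub>R mat 1) + t n *\<^sub>R Q'
        + ((1 - t n) * \<delta>2 - \<delta>) *\<^sub>R mat 1"
      by (simp add: R_def algebra_simps)
    moreover
    have "1 / 2 * \<delta>2 \<le> (1 - t n) * \<delta>2" using t [of n] \<delta>2 by (intro mult_right_mono) auto
    then have "0 \<le> (1 - t n) * \<delta>2 - \<delta>" by (simp add: \<delta>_def)
    moreover have "0 \<le> 1 - t n" "0 \<le> t n" using t [of n] by simp_all
    moreover have "Q' \<in> pos_semidef" using Q' by simp
    ultimately show ?thesis
      by (simp only:) (intro psd_add psd_scaleR \<delta>2 pos_def_imp_psd [OF pos_def_mat_1])
  qed
  have R_pd: "R n \<in> pos_def" for n using \<delta> R_lb by (rule pos_def_of_lower_bound)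
  have R_A: "R n \<in> A" for n unfolding R_def using A QA Q' by (simp add: mem_affine)
  have "t \<longlonglongrightarrow> 0"
    unfolding t_def using LIMSEQ_ignore_initial_segment [OF lim_1_over_n, of 2] by simp
  then have "R \<longlonglongrightarrow> (1 - 0) *\<^sub>R Q + 0 *\<^sub>R Q'"
    unfolding R_def by (intro tendsto_intros)
  then have R_lim: "R \<longlonglongrightarrow> Q" by simp
  have step: "0 \<le> (\<integral>S. (mat 1 - ot_map (R n) S) \<bullet> (Q' - Q) \<partial>P)" for n
  proof -
    have diff: "Q - R n = - (t n *\<^sub>R (Q' - Q))" by (simp add: R_def algebra_simps)
    have "AE S in P. bw_dist_sq (R n) S - bw_dist_sq Q S \<le> t n * ((mat 1 - ot_map (R n) S) \<bullet> (Q' - Q))"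
      using AE_pos_def
    proof eventually_elim
      case (elim S)
      show ?case using bw_dist_sq_subgradient [OF R_pd elim Qs, of n] by (simp add: diff)
    qed
    then have "(\<integral>S. bw_dist_sq (R n) S - bw_dist_sq Q S \<partial>P)
        \<le> (\<integral>S. t n * ((mat 1 - ot_map (R n) S) \<bullet> (Q' - Q)) \<partial>P)"
      by (intro integral_mono_AE Bochner_Integration.integrable_diff bw_integrable Qs pos_def_imp_psd R_pd
          integrable_mult_right integrable_inner_left gradient_integrable)
    then have "population_obj P (R n) - population_obj P Q
        \<le> t n * (\<integral>S. (mat 1 - ot_map (R n) S) \<bullet> (Q' - Q) \<partial>P)"
      using bw_integrable [OF Qs] bw_integrable [OF pos_def_imp_psd [OF R_pd]]
      by (simp add: population_obj_def)
    moreover have "population_obj P Q \<le> population_obj P (R n)"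
      using psd_minimizerD(2) [OF min] R_pd R_A by (simp add: pos_def_imp_psd)
    ultimately have "0 \<le> t n * (\<integral>S. (mat 1 - ot_map (R n) S) \<bullet> (Q' - Q) \<partial>P)" by linarith
    then show ?thesis using t [of n] by (simp add: zero_le_mult_iff)
  qed
  have "(\<lambda>n. \<integral>S. (mat 1 - ot_map (R n) S) \<bullet> (Q' - Q) \<partial>P)
      \<longlonglongrightarrow> (\<integral>S. (mat 1 - ot_map Q S) \<bullet> (Q' - Q) \<partial>P)"
  proof (rule integral_dominated_convergence
      [where w = "\<lambda>S. (norm (mat 1 :: complex^'d^'d) + sqrt (re_trace S / \<delta>)) * norm (Q' - Q)"])
    show "integrable P (\<lambda>S. (norm (mat 1 :: complex^'d^'d) + sqrt (re_trace S / \<delta>)) * norm (Q' - Q))"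
      by (intro integrable_mult_left square_integrable_imp_integrable [OF _ sqrt_trace_sq_integrable [OF \<delta>]])
         measurable
    show "AE S in P. (\<lambda>n. (mat 1 - ot_map (R n) S) \<bullet> (Q' - Q)) \<longlonglongrightarrow> (mat 1 - ot_map Q S) \<bullet> (Q' - Q)"
      by (intro AE_I2 tendsto_intros ot_map_tendsto [OF \<delta> R_lb R_lim]) (simp_all add: space_P)
    show "AE S in P. norm ((mat 1 - ot_map (R n) S) \<bullet> (Q' - Q))
        \<le> (norm (mat 1 :: complex^'d^'d) + sqrt (re_trace S / \<delta>)) * norm (Q' - Q)" for n
    proof (rule AE_I2)
      fix S assume S: "S \<in> space P"
      have "norm ((mat 1 - ot_map (R n) S) \<bullet> (Q' - Q)) \<le> norm (mat 1 - ot_map (R n) S) * norm (Q' - Q)"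
        by (simp add: Cauchy_Schwarz_ineq2)
      also have "\<dots> \<le> (norm (mat 1 :: complex^'d^'d) + sqrt (re_trace S / \<delta>)) * norm (Q' - Q)"
        using S by (intro mult_right_mono norm_gradient_le \<delta> R_lb) (simp_all add: space_P)
      finally show "norm ((mat 1 - ot_map (R n) S) \<bullet> (Q' - Q))
        \<le> (norm (mat 1 :: complex^'d^'d) + sqrt (re_trace S / \<delta>)) * norm (Q' - Q)" .
    qed
  qed (use ot_map_measurable R_pd Q in \<open>auto intro!: borel_measurable_inner borel_measurable_diff\<close>)
  then have "0 \<le> (\<integral>S. (mat 1 - ot_map Q S) \<bullet> (Q' - Q) \<partial>P)"
    by (rule LIMSEQ_le_const) (use step in auto)
  also have "\<dots> = (\<integral>S. mat 1 - ot_map Q S \<partial>P) \<bullet> (Q' - Q)"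
    by (rule integral_inner_left) (rule gradient_integrable [OF Q])
  finally show ?thesis .
qed

end

section \<open>Limit theorems for independent sums\<close>
lemma norm_iexp_diff_le: "norm (iexp a - iexp b) \<le> \<bar>a - b\<bar>"
proof -
  have "iexp a - iexp b = iexp b * (iexp (a - b) - 1)"
    by (simp add: algebra_simps flip: exp_add)
  then have "norm (iexp a - iexp b) = norm (iexp (a - b) - 1)"
    by (simp add: norm_mult)
  also have "\<dots> \<le> \<bar>a - b\<bar>"
    using iexp_approx1 [of "a - b" 0] by simp
  finally show ?thesis .
qed

lemma (in prob_space) char_distr_diff_le:
  assumes [measurable]: "X \<in> borel_measurable M" "Y \<in> borel_measurable M" and "0 \<le> \<epsilon>"
  shows "norm (char (distr M borel X) t - char (distr M borel Y) t)
    \<le> \<bar>t\<bar> * \<epsilon> + 2 * prob {\<omega>\<in>space M. \<epsilon> < \<bar>X \<omega> - Y \<omega>\<bar>}"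
proof -
  let ?B = "{\<omega>\<in>space M. \<epsilon> < \<bar>X \<omega> - Y \<omega>\<bar>}"
  have "?B \<in> sets M" by measurable
  then have B: "integrable M (indicator ?B :: 'a \<Rightarrow> real)"
    by (intro integrable_real_indicator) (simp_all add: less_top [symmetric])
  have int: "integrable M (\<lambda>\<omega>. iexp (t * Z \<omega>))" if [measurable]: "Z \<in> borel_measurable M" for Z
    by (intro integrable_iexp) auto
  have "char (distr M borel X) t - char (distr M borel Y) t
      = (\<integral>\<omega>. iexp (t * X \<omega>) - iexp (t * Y \<omega>) \<partial>M)"
    using Bochner_Integration.integral_diff [OF int [OF assms(1)] int [OF assms(2)]]
    by (simp add: char_def integral_distr)
  also have "norm \<dots> \<le> (\<integral>\<omega>. norm (iexp (t * X \<omega>) - iexp (t * Y \<omega>)) \<partial>M)"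
    by (rule integral_norm_bound)
  also have "\<dots> \<le> (\<integral>\<omega>. \<bar>t\<bar> * \<epsilon> + 2 * indicator ?B \<omega> \<partial>M)"
  proof (rule integral_mono)
    show "integrable M (\<lambda>\<omega>. norm (iexp (t * X \<omega>) - iexp (t * Y \<omega>)))"
      by (intro integrable_norm Bochner_Integration.integrable_diff int) measurable
    fix \<omega> assume \<omega>: "\<omega> \<in> space M"
    show "norm (iexp (t * X \<omega>) - iexp (t * Y \<omega>)) \<le> \<bar>t\<bar> * \<epsilon> + 2 * indicator ?B \<omega>"
    proof (cases "\<omega> \<in> ?B")
      case True
      have "norm (iexp (t * X \<omega>) - iexp (t * Y \<omega>)) \<le> 2"
        by (rule order_trans [OF norm_triangle_ineq4]) simp
      then show ?thesis using True \<open>0 \<le> \<epsilon>\<close> by (simp add: add_increasing)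
    next
      case False
      have "norm (iexp (t * X \<omega>) - iexp (t * Y \<omega>)) \<le> \<bar>t * X \<omega> - t * Y \<omega>\<bar>"
        by (rule norm_iexp_diff_le)
      also have "\<dots> = \<bar>t\<bar> * \<bar>X \<omega> - Y \<omega>\<bar>"
        by (simp add: abs_mult flip: right_diff_distrib)
      also have "\<dots> \<le> \<bar>t\<bar> * \<epsilon>"
        using False \<omega> by (intro mult_left_mono) auto
      finally show ?thesis using False by simp
    qed
  qed (intro Bochner_Integration.integrable_add integrable_mult_right integrable_const B)
  also have "\<dots> = \<bar>t\<bar> * \<epsilon> + 2 * prob ?B"
    using B by (simp add: prob_space)
  finally show ?thesis .
qed

text \<open>Slutsky's lemma: a perturbation that tends to \<open>0\<close> in probability does not change a limit in
distribution. Characteristic functions of \<open>X\<close> and \<open>Y\<close> differ at \<open>t\<close> by at most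
\<open>\<bar>t\<bar> \<epsilon>\<close> off the event \<open>\<bar>X - Y\<bar> > \<epsilon>\<close> and by at most \<open>2\<close> on it.\<close>
lemma (in prob_space) weak_conv_m_close:
  assumes [measurable]: "\<And>n. X n \<in> borel_measurable M" "\<And>n. Y n \<in> borel_measurable M"
    and N: "real_distribution N" and Y: "weak_conv_m (\<lambda>n. distr M borel (Y n)) N"
    and close: "\<And>\<epsilon>. 0 < \<epsilon> \<Longrightarrow> (\<lambda>n. prob {\<omega>\<in>space M. \<epsilon> < \<bar>X n \<omega> - Y n \<omega>\<bar>}) \<longlonglongrightarrow> 0"
  shows "weak_conv_m (\<lambda>n. distr M borel (X n)) N"
proof (rule levy_continuity [OF real_distribution_distr N])
  fix t
  have "(\<lambda>n. char (distr M borel (Y n)) t) \<longlonglongrightarrow> char N t"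
    by (intro levy_continuity1 real_distribution_distr N Y) measurable
  moreover have "(\<lambda>n. char (distr M borel (X n)) t - char (distr M borel (Y n)) t) \<longlonglongrightarrow> 0"
  proof (rule LIMSEQ_I)
    fix e :: real assume "0 < e"
    define \<epsilon> where "\<epsilon> = e / (2 * (\<bar>t\<bar> + 1))"
    have "0 < \<epsilon>" using \<open>0 < e\<close> by (simp add: \<epsilon>_def)
    have "\<bar>t\<bar> * \<epsilon> \<le> e / 2"
      using \<open>0 < e\<close> by (simp add: \<epsilon>_def field_simps)
    obtain n0 where n0: "\<And>n. n \<ge> n0 \<Longrightarrow> prob {\<omega>\<in>space M. \<epsilon> < \<bar>X n \<omega> - Y n \<omega>\<bar>} < e / 4"
      using LIMSEQ_D [OF close [OF \<open>0 < \<epsilon>\<close>], of "e / 4"] \<open>0 < e\<close> by auto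
    have "norm (char (distr M borel (X n)) t - char (distr M borel (Y n)) t - 0) < e" if "n \<ge> n0" for n
      using char_distr_diff_le [of "X n" "Y n" \<epsilon> t] n0 [OF that] \<open>\<bar>t\<bar> * \<epsilon> \<le> e / 2\<close> \<open>0 < \<epsilon>\<close> by simp
    then show "\<exists>no. \<forall>n\<ge>no. norm (char (distr M borel (X n)) t - char (distr M borel (Y n)) t - 0) < e"
      by blast
  qed
  ultimately show "(\<lambda>n. char (distr M borel (X n)) t) \<longlonglongrightarrow> char N t"
    using tendsto_add by fastforce
qed measurable

lemma (in prob_space) weak_conv_m_scale:
  assumes [measurable]: "\<And>n. Y n \<in> borel_measurable M"
    and N: "real_distribution N" and Y: "weak_conv_m (\<lambda>n. distr M borel (Y n)) N"
  shows "weak_conv_m (\<lambda>n. distr M borel (\<lambda>\<omega>. c * Y n \<omega>)) (distr N borel (\<lambda>x. c * x))"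
proof (rule levy_continuity)
  interpret N: real_distribution N by (rule N)
  show "real_distribution (distr N borel (\<lambda>x. c * x))"
    by (rule N.real_distribution_distr) simp
  fix t
  have "(\<lambda>n. char (distr M borel (Y n)) (t * c)) \<longlonglongrightarrow> char N (t * c)"
    by (intro levy_continuity1 real_distribution_distr N Y) measurable
  then show "(\<lambda>n. char (distr M borel (\<lambda>\<omega>. c * Y n \<omega>)) t) \<longlonglongrightarrow> char (distr N borel (\<lambda>x. c * x)) t"
    by (simp add: char_def integral_distr mult.assoc)
qed (auto intro!: real_distribution_distr)

lemma normal_law_eq_distr:
  assumes "0 \<le> v"
  shows "normal_law 0 v = distr std_normal_distribution borel (\<lambda>x. sqrt v * x)"
proof -
  interpret N: real_distribution std_normal_distribution by (rule real_dist_normal_dist)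
  show ?thesis
  proof (cases "v = 0")
    case False
    have "distributed std_normal_distribution lborel (\<lambda>x. x) (normal_density 0 1)"
      by (auto simp: distributed_def intro!: distr_cong distr_id2 [THEN trans])
    from N.normal_density_affine [OF this, of "sqrt v" 0] False assms
    show ?thesis
      by (auto simp: normal_law_def distributed_def cong: distr_cong)
  qed (simp add: normal_law_def)
qed

lemma real_distribution_normal_law: "0 \<le> v \<Longrightarrow> real_distribution (normal_law 0 v)"
  using real_dist_normal_dist
  by (auto simp: normal_law_eq_distr intro!: prob_space.real_distribution_distr
      dest: real_distribution.axioms)

text \<open>The central limit theorem in a form that includes variance \<open>0\<close>, where the summands are almost
surely constant and every normalized sum is almost surely \<open>0\<close>.\<close>
lemma (in prob_space) iid_central_limit:
  fixes X :: "nat \<Rightarrow> 'a \<Rightarrow> real"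
  assumes indep: "indep_vars (\<lambda>i. borel) X UNIV"
    and mean: "\<And>n. expectation (X n) = m"
    and sq: "\<And>n. integrable M (\<lambda>x. (X n x)\<^sup>2)"
    and var: "\<And>n. variance (X n) = v"
    and distr: "\<And>n. distr M borel (X n) = \<mu>"
  shows "weak_conv_m (\<lambda>n. distr M borel (\<lambda>\<omega>. (\<Sum>i<n. X i \<omega> - m) / sqrt (real n))) (normal_law 0 v)"
proof -
  have [measurable]: "X n \<in> borel_measurable M" for n
    using indep by (simp add: indep_vars_def)
  have "0 \<le> v" using variance_positive [of "X 0"] var by simp
  show ?thesis
  proof (cases "v = 0")
    case True
    have "AE \<omega> in M. X i \<omega> = m" for i
    proof -
      have "integrable M (X i)"
        by (rule square_integrable_imp_integrable [OF _ sq]) simp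
      then have "integrable M (\<lambda>\<omega>. (X i \<omega> - m)\<^sup>2)"
        using sq by (auto simp: power2_diff)
      moreover have "expectation (\<lambda>\<omega>. (X i \<omega> - m)\<^sup>2) = 0"
        using var [of i] True mean [of i] by simp
      ultimately have "AE \<omega> in M. (X i \<omega> - m)\<^sup>2 = 0"
        using integral_nonneg_eq_0_iff_AE [of M "\<lambda>\<omega>. (X i \<omega> - m)\<^sup>2"] by simp
      then show ?thesis by simp
    qed
    then have "AE \<omega> in M. \<forall>i. X i \<omega> = m" by (simp add: AE_all_countable)
    then have "distr M borel (\<lambda>\<omega>. (\<Sum>i<n. X i \<omega> - m) / sqrt (real n)) = distr M borel (\<lambda>\<omega>. 0)" for n
      by (intro distr_cong_AE) auto
    then show ?thesis
      by (simp add: normal_law_def True weak_conv_m_def weak_conv_def)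
  next
    case False
    then have v: "0 < sqrt v" "(sqrt v)\<^sup>2 = v" using \<open>0 \<le> v\<close> by auto
    have "weak_conv_m (\<lambda>n. distr M borel (\<lambda>x. (\<Sum>i<n. X i x - m) / sqrt (n * (sqrt v)\<^sup>2)))
        std_normal_distribution"
      by (intro central_limit_theorem [OF indep mean v(1) sq _ distr]) (simp add: var v)
    then have "weak_conv_m (\<lambda>n. distr M borel (\<lambda>x. sqrt v * ((\<Sum>i<n. X i x - m) / sqrt (n * (sqrt v)\<^sup>2))))
        (normal_law 0 v)"
      unfolding normal_law_eq_distr [OF \<open>0 \<le> v\<close>]
      by (intro weak_conv_m_scale real_dist_normal_dist) measurable
    then show ?thesis using v by (simp add: real_sqrt_mult)
  qed
qed

lemma (in prob_space) indep_centred_sum_variance: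
  fixes X :: "nat \<Rightarrow> 'a \<Rightarrow> real"
  assumes indep: "indep_vars (\<lambda>i. borel) X UNIV"
    and mean: "\<And>i. expectation (X i) = 0"
    and sq: "\<And>i. integrable M (\<lambda>\<omega>. (X i \<omega>)\<^sup>2)"
  shows "integrable M (\<lambda>\<omega>. (\<Sum>i<n. X i \<omega>)\<^sup>2)
    \<and> expectation (\<lambda>\<omega>. (\<Sum>i<n. X i \<omega>)\<^sup>2) = (\<Sum>i<n. expectation (\<lambda>\<omega>. (X i \<omega>)\<^sup>2))"
proof (induction n)
  case (Suc n)
  have [measurable]: "X n \<in> borel_measurable M" for n
    using indep by (simp add: indep_vars_def)
  have int: "integrable M (X i)" for i
    by (rule square_integrable_imp_integrable [OF _ sq]) simp
  have "indep_var borel (X n) borel (\<lambda>\<omega>. \<Sum>i<n. X i \<omega>)"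
    by (rule indep_vars_sum) (auto intro: indep_vars_subset [OF indep])
  note * = indep_var_integrable [OF this int] indep_var_lebesgue_integral [OF this int]
  show ?case
    using Suc sq * by (simp add: power2_sum int mean algebra_simps)
qed simp

text \<open>Bienayme's identity in each coordinate.\<close>
lemma (in prob_space) indep_centred_sum_norm:
  fixes X :: "nat \<Rightarrow> 'a \<Rightarrow> 'b::euclidean_space"
  assumes indep: "indep_vars (\<lambda>i. borel) X UNIV"
    and int: "\<And>i. integrable M (X i)"
    and mean: "\<And>i. expectation (X i) = 0"
    and sq: "\<And>i. integrable M (\<lambda>\<omega>. (norm (X i \<omega>))\<^sup>2)"
  shows "integrable M (\<lambda>\<omega>. (norm (\<Sum>i<n. X i \<omega>))\<^sup>2)"
    and "expectation (\<lambda>\<omega>. (norm (\<Sum>i<n. X i \<omega>))\<^sup>2) = (\<Sum>i<n. expectation (\<lambda>\<omega>. (norm (X i \<omega>))\<^sup>2))"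
proof -
  have [measurable]: "X n \<in> borel_measurable M" for n
    using indep by (simp add: indep_vars_def)
  have norm: "(norm x)\<^sup>2 = (\<Sum>b\<in>Basis. (x \<bullet> b)\<^sup>2)" for x :: 'b
    unfolding power2_norm_eq_inner by (subst euclidean_inner) (simp add: power2_eq_square)
  have le: "(x \<bullet> b)\<^sup>2 \<le> (norm x)\<^sup>2" if "b \<in> Basis" for x b :: 'b
    using Basis_le_norm [OF that, of x] by (simp flip: abs_le_square_iff)
  have sqb: "integrable M (\<lambda>\<omega>. (X i \<omega> \<bullet> b)\<^sup>2)" if "b \<in> Basis" for i b
    by (rule Bochner_Integration.integrable_bound [OF sq [of i]])
       (simp_all add: le that)
  have indep_b: "indep_vars (\<lambda>i. borel) (\<lambda>i \<omega>. X i \<omega> \<bullet> b) UNIV" for b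
    using indep by (rule indep_vars_compose2) auto
  have mean_b: "expectation (\<lambda>\<omega>. X i \<omega> \<bullet> b) = 0" for i b
    using int mean by simp
  note * = indep_centred_sum_variance [OF indep_b mean_b sqb]
  have "integrable M (\<lambda>\<omega>. \<Sum>b\<in>Basis. (\<Sum>i<n. X i \<omega> \<bullet> b)\<^sup>2)"
    using * by (intro Bochner_Integration.integrable_sum) blast
  then show "integrable M (\<lambda>\<omega>. (norm (\<Sum>i<n. X i \<omega>))\<^sup>2)"
    by (simp add: norm inner_sum_left)
  have "expectation (\<lambda>\<omega>. (norm (\<Sum>i<n. X i \<omega>))\<^sup>2)
      = (\<Sum>b\<in>Basis. \<Sum>i<n. expectation (\<lambda>\<omega>. (X i \<omega> \<bullet> b)\<^sup>2))"
    using * by (simp add: norm inner_sum_left)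
  also have "\<dots> = (\<Sum>i<n. \<Sum>b\<in>Basis. expectation (\<lambda>\<omega>. (X i \<omega> \<bullet> b)\<^sup>2))"
    by (rule sum.swap)
  also have "\<dots> = (\<Sum>i<n. expectation (\<lambda>\<omega>. (norm (X i \<omega>))\<^sup>2))"
    using sqb by (simp add: norm)
  finally show "expectation (\<lambda>\<omega>. (norm (\<Sum>i<n. X i \<omega>))\<^sup>2) = \<dots>" .
qed

text \<open>Chebyshev's inequality for vector-valued sums. With \<open>a\<close> of order \<open>n\<^sup>1\<^sup>/\<^sup>2\<close> it gives tightness of
the normalized sums; with \<open>a\<close> of order \<open>n\<close>, the weak law of large numbers.\<close>
lemma iid_sum_tail:
  fixes g :: "'s \<Rightarrow> 'b::euclidean_space"
  assumes M: "prob_space M" and indep: "prob_space.indep_vars M (\<lambda>_. P) X UNIV"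
    and distr: "\<And>i. distr M P (X i) = P"
    and g [measurable]: "g \<in> borel_measurable P" and sq: "integrable P (\<lambda>s. (norm (g s))\<^sup>2)" and "0 < a"
  shows "measure M {\<omega>\<in>space M. a \<le> norm ((\<Sum>i<n. g (X i \<omega>)) - real n *\<^sub>R (\<integral>s. g s \<partial>P))}
    \<le> real n * (\<integral>s. (norm (g s - (\<integral>s. g s \<partial>P)))\<^sup>2 \<partial>P) / a\<^sup>2"
proof -
  interpret prob_space M by (rule M)
  have X [measurable]: "X i \<in> measurable M P" for i using indep by (simp add: indep_vars_def)
  interpret P: prob_space P using prob_space_distr [OF X [of 0]] by (simp add: distr)
  let ?m = "\<integral>s. g s \<partial>P"
  define h where "h s = g s - ?m" for s
  have [measurable]: "h \<in> borel_measurable P" unfolding h_def by measurable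
  have "integrable P (\<lambda>s. norm (g s))"
    by (rule P.square_integrable_imp_integrable [OF _ sq]) simp
  then have intg: "integrable P g" by (simp add: integrable_norm_iff)
  then have inth: "integrable P h" "integral\<^sup>L P h = 0"
    by (simp_all add: h_def [abs_def] P.prob_space)
  have sqh: "integrable P (\<lambda>s. (norm (h s))\<^sup>2)"
  proof -
    have "integrable P (\<lambda>s. (norm (g s))\<^sup>2 + (norm ?m)\<^sup>2 - 2 * (g s \<bullet> ?m))"
      using sq intg by simp
    then show ?thesis
      by (simp add: h_def power2_norm_eq_inner inner_diff_left inner_diff_right inner_commute)
  qed
  have tr: "integrable M (\<lambda>\<omega>. h (X i \<omega>))" "expectation (\<lambda>\<omega>. h (X i \<omega>)) = 0"
    "integrable M (\<lambda>\<omega>. (norm (h (X i \<omega>)))\<^sup>2)"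
    "expectation (\<lambda>\<omega>. (norm (h (X i \<omega>)))\<^sup>2) = (\<integral>s. (norm (h s))\<^sup>2 \<partial>P)" for i
    using inth sqh integrable_distr_eq [OF X, of h i] integral_distr [OF X, of h i]
      integrable_distr_eq [OF X, of "\<lambda>s. (norm (h s))\<^sup>2" i]
      integral_distr [OF X, of "\<lambda>s. (norm (h s))\<^sup>2" i] by (simp_all add: distr)
  have "indep_vars (\<lambda>_. borel) (\<lambda>i \<omega>. h (X i \<omega>)) UNIV"
    using indep by (rule indep_vars_compose2) simp
  note * = indep_centred_sum_norm [OF this tr(1-3), of n]
  have "prob {\<omega>\<in>space M. a\<^sup>2 \<le> (norm (\<Sum>i<n. h (X i \<omega>)))\<^sup>2}
      \<le> expectation (\<lambda>\<omega>. (norm (\<Sum>i<n. h (X i \<omega>)))\<^sup>2) / a\<^sup>2"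
    using \<open>0 < a\<close> by (intro integral_Markov_inequality_measure [where A = "{}"] *) auto
  also have "\<dots> = real n * (\<integral>s. (norm (h s))\<^sup>2 \<partial>P) / a\<^sup>2"
    by (simp add: * tr)
  finally show ?thesis
    using \<open>0 < a\<close> by (simp add: h_def sum_subtractf sum_constant_scaleR power_mono_iff)
qed

lemma iid_sum_pos:
  fixes h :: "'s \<Rightarrow> real"
  assumes M: "prob_space M" and indep: "prob_space.indep_vars M (\<lambda>_. P) X UNIV"
    and distr: "\<And>i. distr M P (X i) = P"
    and h [measurable]: "h \<in> borel_measurable P" and sq: "integrable P (\<lambda>s. (h s)\<^sup>2)"
    and pos: "0 < (\<integral>s. h s \<partial>P)"
  shows "(\<lambda>n. measure M {\<omega>\<in>space M. (\<Sum>i<n. h (X i \<omega>)) \<le> 0}) \<longlonglongrightarrow> 0"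
proof -
  interpret prob_space M by (rule M)
  have X [measurable]: "X i \<in> measurable M P" for i using indep by (simp add: indep_vars_def)
  let ?m = "\<integral>s. h s \<partial>P"
  let ?v = "\<integral>s. (norm (h s - ?m))\<^sup>2 \<partial>P"
  have "prob {\<omega>\<in>space M. (\<Sum>i<n. h (X i \<omega>)) \<le> 0} \<le> (?v / ?m\<^sup>2) * (1 / real n)" if "n > 0" for n
  proof -
    have "prob {\<omega>\<in>space M. (\<Sum>i<n. h (X i \<omega>)) \<le> 0}
        \<le> prob {\<omega>\<in>space M. real n * ?m \<le> norm ((\<Sum>i<n. h (X i \<omega>)) - real n *\<^sub>R ?m)}"
      using pos by (intro finite_measure_mono) auto
    also have "\<dots> \<le> real n * ?v / (real n * ?m)\<^sup>2"
      using iid_sum_tail [OF M indep distr h, where a = "real n * ?m"] sq pos that by simp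
    also have "\<dots> = (?v / ?m\<^sup>2) * (1 / real n)"
      using that by (simp add: power2_eq_square)
    finally show ?thesis .
  qed
  then have ev: "\<forall>\<^sub>F n in sequentially.
      prob {\<omega>\<in>space M. (\<Sum>i<n. h (X i \<omega>)) \<le> 0} \<le> (?v / ?m\<^sup>2) * (1 / real n)"
    by (intro eventually_sequentiallyI [of 1]) simp
  have lim: "(\<lambda>n. (?v / ?m\<^sup>2) * (1 / real n)) \<longlonglongrightarrow> 0"
    by (rule tendsto_mult_right_zero [OF lim_1_over_n])
  show ?thesis
    by (rule tendsto_sandwich [OF _ ev tendsto_const lim]) simp
qed

section \<open>Optimal values of convex stochastic programs\<close>
lemma integrable_power2_diff:
  fixes a b :: "'s \<Rightarrow> real"
  assumes [measurable]: "a \<in> borel_measurable P" "b \<in> borel_measurable P"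
    and "integrable P (\<lambda>s. (a s)\<^sup>2)" "integrable P (\<lambda>s. (b s)\<^sup>2)"
  shows "integrable P (\<lambda>s. (a s - b s)\<^sup>2)"
proof (rule Bochner_Integration.integrable_bound)
  show "integrable P (\<lambda>s. 2 * (a s)\<^sup>2 + 2 * (b s)\<^sup>2)" using assms by simp
  have "(x - y)\<^sup>2 \<le> 2 * x\<^sup>2 + 2 * y\<^sup>2" for x y :: real
    using zero_le_power2 [of "x + y"] by (simp add: power2_sum power2_diff)
  then show "AE s in P. norm ((a s - b s)\<^sup>2) \<le> norm (2 * (a s)\<^sup>2 + 2 * (b s)\<^sup>2)"
    by simp
qed measurable

lemma convex_on_finite_sum:
  assumes "finite I" "convex C" "\<And>i. i \<in> I \<Longrightarrow> convex_on C (\<phi> i)"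
  shows "convex_on C (\<lambda>p. \<Sum>i\<in>I. \<phi> i p)"
  using assms by (induction I rule: finite_induct) (auto intro: convex_on_add simp: convex_on_const)

text \<open>A convex function that is nowhere on the sphere below its value at the centre \<open>q\<close> is nowhere
outside the ball below it, since the segment from \<open>q\<close> crosses the sphere. Inside the ball, the
gradient \<open>G\<close> can decrease \<open>F\<close> only through its deviation from \<open>m\<close>.\<close>
lemma convex_on_lower_bound_from_sphere:
  fixes F :: "'a::real_inner \<Rightarrow> real"
  assumes conv: "convex_on C F" and q: "q \<in> C" and "0 < r"
    and sphere: "\<And>p. p \<in> C \<Longrightarrow> norm (p - q) = r \<Longrightarrow> F q \<le> F p"
    and grad: "\<And>p. p \<in> C \<Longrightarrow> F q + G \<bullet> (p - q) \<le> F p"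
    and foc: "\<And>p. p \<in> C \<Longrightarrow> 0 \<le> m \<bullet> (p - q)"
    and dev: "norm (G - m) \<le> \<kappa>" and p: "p \<in> C"
  shows "F q - \<kappa> * r \<le> F p"
proof (cases "norm (p - q) \<le> r")
  case True
  have "(m - G) \<bullet> (p - q) \<le> norm (m - G) * norm (p - q)" by (rule norm_cauchy_schwarz)
  also have "\<dots> \<le> \<kappa> * r"
    using dev True by (intro mult_mono') (simp_all add: norm_minus_commute)
  finally show ?thesis
    using grad [OF p] foc [OF p] by (simp add: inner_diff_left)
next
  case False
  define t where "t = r / norm (p - q)"
  have "r < norm (p - q)" "0 < norm (p - q)" using False \<open>0 < r\<close> by linarith+
  then have t: "0 < t" "t \<le> 1" using \<open>0 < r\<close> by (simp_all add: t_def)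
  define p' where "p' = (1 - t) *\<^sub>R q + t *\<^sub>R p"
  have "p' - q = t *\<^sub>R (p - q)" by (simp add: p'_def algebra_simps)
  moreover have "p \<noteq> q" using False \<open>0 < r\<close> by auto
  ultimately have "norm (p' - q) = r" using t \<open>0 < r\<close> by (simp add: t_def)
  moreover have "p' \<in> C"
    using conv q p t unfolding p'_def convex_on_def by (intro convexD_alt) auto
  ultimately have "F q \<le> F p'" by (intro sphere)
  also have "\<dots> \<le> (1 - t) * F q + t * F p"
    using convex_onD [OF conv, of t q p] t q p by (simp add: p'_def)
  finally have "t * F q \<le> t * F p" by (simp add: algebra_simps)
  then have "F q \<le> F p" using t by simp
  moreover have "0 \<le> \<kappa> * r" using dev norm_ge_zero [of "G - m"] \<open>0 < r\<close> by (intro mult_nonneg_nonneg) linarith+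
  ultimately show ?thesis by simp
qed

text \<open>A sample average approximation of a convex stochastic program with unique solution \<open>q\<close> has optimal
values that fluctuate like the averages of the loss at \<open>q\<close>. Let \<open>F\<close> be the empirical objective,
\<open>V\<close> its infimum and \<open>F q\<close> the average of the loss at \<open>q\<close>. Then \<open>V \<le> F q\<close>, and it remains to bound
\<open>n\<^sup>1\<^sup>/\<^sup>2 (F q - V)\<close> by an arbitrary \<open>\<epsilon>\<close> with high probability.

By \<open>convex_on_lower_bound_from_sphere\<close> this quantity is at most \<open>K r\<close> on the event that the
empirical mean of the gradients \<open>g\<close> is within \<open>K n\<^sup>-\<^sup>1\<^sup>/\<^sup>2\<close> of its expectation and \<open>F q\<close> does not
exceed \<open>F\<close> on the sphere of radius \<open>r\<close>. First \<open>K\<close> is chosen large, so that the former is likely by Chebyshev's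
inequality; then \<open>r = \<epsilon> / K\<close>, or smaller. On the compact sphere the expected loss exceeds the
minimum, and the Lipschitz condition reduces the comparison to finitely many
points, at which the law of large numbers applies.\<close>
theorem convex_value_central_limit:
  fixes f :: "'a::euclidean_space \<Rightarrow> 's \<Rightarrow> real" and g :: "'s \<Rightarrow> 'a" and L :: "'s \<Rightarrow> real"
  assumes M: "prob_space M" and indep: "prob_space.indep_vars M (\<lambda>_. P) X UNIV"
    and distr: "\<And>i. distr M P (X i) = P"
    and C: "closed C" and q: "q \<in> C" and \<eta>: "0 < \<eta>"
    and f [measurable]: "\<And>p. p \<in> C \<Longrightarrow> f p \<in> borel_measurable P"
    and f_sq: "\<And>p. p \<in> C \<Longrightarrow> integrable P (\<lambda>s. (f p s)\<^sup>2)"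
    and g [measurable]: "g \<in> borel_measurable P" and g_sq: "integrable P (\<lambda>s. (norm (g s))\<^sup>2)"
    and L [measurable]: "L \<in> borel_measurable P" and L_sq: "integrable P (\<lambda>s. (L s)\<^sup>2)"
    and convex: "AE s in P. convex_on C (\<lambda>p. f p s)"
    and nonneg: "AE s in P. \<forall>p\<in>C. 0 \<le> f p s"
    and grad: "AE s in P. \<forall>p\<in>C. f q s + g s \<bullet> (p - q) \<le> f p s"
    and lip: "AE s in P. 0 \<le> L s \<and>
      (\<forall>p\<in>C \<inter> cball q \<eta>. \<forall>p'\<in>C \<inter> cball q \<eta>. f p s - f p' s \<le> L s * norm (p - p'))"
    and foc: "\<And>p. p \<in> C \<Longrightarrow> 0 \<le> (\<integral>s. g s \<partial>P) \<bullet> (p - q)"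
    and unique: "\<And>p. p \<in> C \<Longrightarrow> p \<noteq> q \<Longrightarrow> (\<integral>s. f q s \<partial>P) < (\<integral>s. f p s \<partial>P)"
    and V_meas: "\<And>n. (\<lambda>\<omega>. INF p\<in>C. 1 / real n * (\<Sum>i<n. f p (X i \<omega>))) \<in> borel_measurable M"
  shows "weak_conv_m (\<lambda>n. distr M borel (\<lambda>\<omega>.
      sqrt (real n) * ((INF p\<in>C. 1 / real n * (\<Sum>i<n. f p (X i \<omega>))) - (\<integral>s. f q s \<partial>P))))
    (normal_law 0 (prob_space.variance P (f q)))"
proof -
  interpret prob_space M by (rule M)
  have X [measurable]: "X i \<in> measurable M P" for i using indep by (simp add: indep_vars_def)
  interpret P: prob_space P using prob_space_distr [OF X [of 0]] by (simp add: distr)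
  have fq [measurable]: "f q \<in> borel_measurable P" using q by (rule f)
  define v where "v = (\<integral>s. f q s \<partial>P)"
  define m where "m = (\<integral>s. g s \<partial>P)"
  define W where "W = (\<integral>s. (norm (g s - m))\<^sup>2 \<partial>P)"
  define F where "F n \<omega> p = 1 / real n * (\<Sum>i<n. f p (X i \<omega>))" for n \<omega> p
  define V where "V n \<omega> = (INF p\<in>C. F n \<omega> p)" for n \<omega>
  have V [measurable]: "V n \<in> borel_measurable M" for n using V_meas by (simp add: V_def [abs_def] F_def)
  define Y where "Y n \<omega> = (\<Sum>i<n. f q (X i \<omega>) - v) / sqrt (real n)" for n \<omega>
  define Z where "Z n \<omega> = sqrt (real n) * (V n \<omega> - v)" for n \<omega>
  have [measurable]: "Y n \<in> borel_measurable M" "Z n \<in> borel_measurable M" for n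
    by (simp_all add: Y_def [abs_def] Z_def [abs_def])
  have f_int: "integrable P (f p)" if "p \<in> C" for p
    by (rule P.square_integrable_imp_integrable [OF f f_sq]) (rule that)+
  have L_int: "integrable P L"
    by (rule P.square_integrable_imp_integrable [OF L L_sq])
  have L0: "0 \<le> (\<integral>s. L s \<partial>P)"
    by (rule integral_nonneg_AE) (use lip in auto)

  \<comment> \<open>The upper bound \<open>Y\<close> for the normalized value \<open>Z\<close> has the claimed limit.\<close>
  have Y_lim: "weak_conv_m (\<lambda>n. distr M borel (Y n)) (normal_law 0 (P.variance (f q)))"
    unfolding Y_def
  proof (rule iid_central_limit)
    show "indep_vars (\<lambda>i. borel) (\<lambda>i \<omega>. f q (X i \<omega>)) UNIV"
      using indep by (rule indep_vars_compose2) simp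
    show "expectation (\<lambda>\<omega>. f q (X i \<omega>)) = v" for i
      using integral_distr [OF X, of "f q" i] by (simp add: distr v_def)
    then show "variance (\<lambda>\<omega>. f q (X i \<omega>)) = P.variance (f q)" for i
      using integral_distr [OF X, of "\<lambda>s. (f q s - v)\<^sup>2" i] by (simp add: distr v_def)
    show "integrable M (\<lambda>\<omega>. (f q (X i \<omega>))\<^sup>2)" for i
      using integrable_distr_eq [OF X, of "\<lambda>s. (f q s)\<^sup>2" i] f_sq [OF q] by (simp add: distr)
    show "distr M borel (\<lambda>\<omega>. f q (X i \<omega>)) = distr P borel (f q)" for i
      using distr_distr [OF fq X, of i] by (simp add: distr o_def)
  qed

  define good where "good s \<longleftrightarrow> convex_on C (\<lambda>p. f p s) \<and> (\<forall>p\<in>C. 0 \<le> f p s) \<and>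
      (\<forall>p\<in>C. f q s + g s \<bullet> (p - q) \<le> f p s) \<and> 0 \<le> L s \<and>
      (\<forall>p\<in>C \<inter> cball q \<eta>. \<forall>p'\<in>C \<inter> cball q \<eta>. f p s - f p' s \<le> L s * norm (p - p'))" for s
  have AE_good: "AE s in P. good s"
    using convex nonneg grad lip unfolding good_def by eventually_elim blast
  have "AE \<omega> in M. good (X i \<omega>)" for i
    by (rule AE_distrD [OF X]) (unfold distr, rule AE_good)
  then have good: "AE \<omega> in M. \<forall>i. good (X i \<omega>)" by (simp add: AE_all_countable)

  \<comment> \<open>The deterministic comparison on the event described above.\<close>
  have det: "\<bar>Z n \<omega> - Y n \<omega>\<bar> \<le> K * r"
    if n: "0 < n" and g_\<omega>: "\<And>i. good (X i \<omega>)" and "0 \<le> K" and r: "0 < r"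
      and dev: "norm ((\<Sum>i<n. g (X i \<omega>)) - real n *\<^sub>R m) \<le> K * sqrt (real n)"
      and sphere: "\<And>p. p \<in> C \<Longrightarrow> norm (p - q) = r \<Longrightarrow> F n \<omega> q \<le> F n \<omega> p"
    for n \<omega> K r
  proof -
    have conv: "convex_on C (F n \<omega>)"
      unfolding F_def using g_\<omega>
      by (intro convex_on_cmul convex_on_finite_sum) (auto simp: good_def convex_on_def)
    define G where "G = (1 / real n) *\<^sub>R (\<Sum>i<n. g (X i \<omega>))"
    have "G - m = (1 / real n) *\<^sub>R ((\<Sum>i<n. g (X i \<omega>)) - real n *\<^sub>R m)"
      using n by (simp add: G_def scaleR_diff_right)
    then have "norm (G - m) = norm ((\<Sum>i<n. g (X i \<omega>)) - real n *\<^sub>R m) / real n"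
      using n by simp
    also have "\<dots> \<le> K * sqrt (real n) / real n"
      using dev by (intro divide_right_mono) simp_all
    also have "\<dots> = K / sqrt (real n)"
      by (simp add: real_div_sqrt flip: times_divide_eq_right) (simp add: sqrt_divide_self_eq field_simps)
    finally have dev': "norm (G - m) \<le> K / sqrt (real n)" .
    have grad': "F n \<omega> q + G \<bullet> (p - q) \<le> F n \<omega> p" if "p \<in> C" for p
    proof -
      have "(\<Sum>i<n. f q (X i \<omega>)) + (\<Sum>i<n. g (X i \<omega>)) \<bullet> (p - q) \<le> (\<Sum>i<n. f p (X i \<omega>))"
        unfolding inner_sum_left sum.distrib [symmetric]
        using g_\<omega> that by (intro sum_mono) (auto simp: good_def)
      from divide_right_mono [OF this, of "real n"] show ?thesis
        by (simp add: F_def G_def add_divide_distrib)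
    qed
    have lower: "F n \<omega> q - K / sqrt (real n) * r \<le> F n \<omega> p" if "p \<in> C" for p
      using convex_on_lower_bound_from_sphere [OF conv q r sphere grad' _ dev' that] foc
      by (simp add: m_def)
    have "F n \<omega> q - K / sqrt (real n) * r \<le> V n \<omega>"
      unfolding V_def using q lower by (intro cINF_greatest) auto
    moreover have "V n \<omega> \<le> F n \<omega> q"
      unfolding V_def using q g_\<omega>
      by (intro cINF_lower bdd_belowI [of _ 0]) (auto simp: F_def good_def intro!: divide_nonneg_nonneg sum_nonneg)
    ultimately have "\<bar>V n \<omega> - F n \<omega> q\<bar> \<le> K / sqrt (real n) * r" by linarith
    moreover have "Z n \<omega> - Y n \<omega> = sqrt (real n) * (V n \<omega> - F n \<omega> q)"
    proof -
      have "Y n \<omega> = ((\<Sum>i<n. f q (X i \<omega>)) - real n * v) / sqrt (real n)"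
        by (simp add: Y_def sum_subtractf)
      also have "\<dots> = sqrt (real n) * (F n \<omega> q - v)"
        using n by (simp add: F_def field_simps)
      finally show ?thesis by (simp add: Z_def algebra_simps)
    qed
    ultimately have "\<bar>Z n \<omega> - Y n \<omega>\<bar> \<le> sqrt (real n) * (K / sqrt (real n) * r)"
      by (simp only: abs_mult) (simp add: mult_left_mono del: times_divide_eq_left)
    also have "\<dots> = K * r" using n by simp
    finally show ?thesis .
  qed

  have "(\<lambda>n. prob {\<omega>\<in>space M. \<epsilon> < \<bar>Z n \<omega> - Y n \<omega>\<bar>}) \<longlonglongrightarrow> 0" if \<epsilon>: "0 < \<epsilon>" for \<epsilon>
  proof (rule LIMSEQ_I)
    fix e :: real assume e: "0 < e"
    have "0 \<le> W" by (simp add: W_def)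
    \<comment> \<open>Large enough for \<open>W / K\<^sup>2 < e / 2\<close>.\<close>
    define K where "K = 1 + 2 * W / e"
    have K: "1 \<le> K" using e \<open>0 \<le> W\<close> by (simp add: K_def)
    have "W < e / 2 * K" using e by (simp add: K_def algebra_simps)
    also have "\<dots> \<le> e / 2 * K\<^sup>2" using e K by (simp add: power2_eq_square)
    finally have WK: "W / K\<^sup>2 < e / 2" using K by (simp add: field_simps)
    define r where "r = min \<eta> (\<epsilon> / K)"
    have r: "0 < r" "r \<le> \<eta>" "K * r \<le> \<epsilon>"
      using \<eta> \<epsilon> K by (auto simp: r_def min_def field_simps)
    define D where "D = C \<inter> sphere q r"
    have "compact D" unfolding D_def using C by (intro closed_Int_compact compact_sphere)
    define \<mu> where "\<mu> p = (\<integral>s. f p s \<partial>P) - v" for p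
    have \<mu>: "0 < \<mu> p" if "p \<in> D" for p
      using that unique [of p] r by (auto simp: D_def \<mu>_def v_def)
    \<comment> \<open>In the ball of radius \<open>\<rho> p\<close> around \<open>p\<close> the loss exceeds the loss at \<open>q\<close> by at least
      \<open>h p\<close>, which has positive expectation because \<open>\<rho> p\<close> is small enough.\<close>
    define \<rho> where "\<rho> p = \<mu> p / ((\<integral>s. L s \<partial>P) + 1)" for p
    have \<rho>: "0 < \<rho> p" if "p \<in> D" for p using \<mu> [OF that] L0 by (simp add: \<rho>_def)
    define h where "h p s = f p s - f q s - \<rho> p * L s" for p s
    have h [measurable]: "h p \<in> borel_measurable P" if "p \<in> D" for p
      using that f [of p] by (simp add: h_def [abs_def] D_def)
    have h_sq: "integrable P (\<lambda>s. (h p s)\<^sup>2)" if "p \<in> D" for p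
      unfolding h_def using that q f_sq L_sq
      by (intro integrable_power2_diff) (auto simp: D_def power_mult_distrib)
    have h_pos: "0 < (\<integral>s. h p s \<partial>P)" if "p \<in> D" for p
    proof -
      have "(\<integral>s. h p s \<partial>P) = \<mu> p - \<rho> p * (\<integral>s. L s \<partial>P)"
        using that q by (simp add: h_def f_int L_int \<mu>_def v_def D_def)
      also have "\<dots> = \<rho> p"
        using L0 by (simp add: \<rho>_def field_simps)
      finally show ?thesis using \<rho> [OF that] by simp
    qed
    obtain T where T: "T \<subseteq> D" "finite T" "D \<subseteq> (\<Union>p\<in>T. ball p (\<rho> p))"
      using compactE_image [OF \<open>compact D\<close>, of D "\<lambda>p. ball p (\<rho> p)"] \<rho> by force
    let ?B = "\<lambda>p n. {\<omega>\<in>space M. (\<Sum>i<n. h p (X i \<omega>)) \<le> 0}"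
    let ?A = "\<lambda>n. {\<omega>\<in>space M. K * sqrt (real n) \<le> norm ((\<Sum>i<n. g (X i \<omega>)) - real n *\<^sub>R m)}"
    have "(\<lambda>n. \<Sum>p\<in>T. prob (?B p n)) \<longlonglongrightarrow> (\<Sum>p\<in>T. 0)"
      using T by (intro tendsto_sum iid_sum_pos [OF M indep distr h h_sq h_pos]) auto
    then have "(\<lambda>n. \<Sum>p\<in>T. prob (?B p n)) \<longlonglongrightarrow> 0" by simp
    from LIMSEQ_D [OF this, of "e / 2"] e
    obtain n1 where n1: "\<And>n. n1 \<le> n \<Longrightarrow> \<bar>\<Sum>p\<in>T. prob (?B p n)\<bar> < e / 2"
      by auto
    have "prob {\<omega>\<in>space M. \<epsilon> < \<bar>Z n \<omega> - Y n \<omega>\<bar>} < e" if n: "max 1 n1 \<le> n" for n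
    proof -
      have meas_B: "?B p n \<in> sets M" if "p \<in> T" for p
      proof -
        have [measurable]: "h p \<in> borel_measurable P" using that T by (intro h) auto
        show ?thesis by measurable
      qed
      have "prob {\<omega>\<in>space M. \<epsilon> < \<bar>Z n \<omega> - Y n \<omega>\<bar>} \<le> prob (?A n \<union> (\<Union>p\<in>T. ?B p n))"
      proof (rule finite_measure_mono_AE)
        show "AE \<omega> in M. \<omega> \<in> {\<omega>\<in>space M. \<epsilon> < \<bar>Z n \<omega> - Y n \<omega>\<bar>} \<longrightarrow> \<omega> \<in> ?A n \<union> (\<Union>p\<in>T. ?B p n)"
          using good
        proof eventually_elim
          case (elim \<omega>)
          show ?case
          proof (rule impI, rule ccontr)
            assume \<omega>: "\<omega> \<in> {\<omega>\<in>space M. \<epsilon> < \<bar>Z n \<omega> - Y n \<omega>\<bar>}" and "\<omega> \<notin> ?A n \<union> (\<Union>p\<in>T. ?B p n)"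
            then have dev: "norm ((\<Sum>i<n. g (X i \<omega>)) - real n *\<^sub>R m) \<le> K * sqrt (real n)"
              and pos: "\<And>p. p \<in> T \<Longrightarrow> 0 < (\<Sum>i<n. h p (X i \<omega>))" by auto
            have sphere: "F n \<omega> q \<le> F n \<omega> p'" if "p' \<in> C" "norm (p' - q) = r" for p'
            proof -
              have "p' \<in> D" using that by (simp add: D_def dist_norm norm_minus_commute)
              then obtain p where p: "p \<in> T" "dist p p' < \<rho> p" using T(3) by force
              then have "p \<in> D" using T by blast
              have "(\<Sum>i<n. f p (X i \<omega>) - f p' (X i \<omega>)) \<le> (\<Sum>i<n. \<rho> p * L (X i \<omega>))"
              proof (rule sum_mono)
                fix i
                have "f p (X i \<omega>) - f p' (X i \<omega>) \<le> L (X i \<omega>) * norm (p - p')"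
                  using elim \<open>p \<in> D\<close> \<open>p' \<in> D\<close> r unfolding good_def D_def by force
                also have "\<dots> \<le> L (X i \<omega>) * \<rho> p"
                  using elim p by (intro mult_left_mono) (auto simp: good_def dist_norm)
                finally show "f p (X i \<omega>) - f p' (X i \<omega>) \<le> \<rho> p * L (X i \<omega>)"
                  by (simp add: mult.commute)
              qed
              then have "(\<Sum>i<n. f q (X i \<omega>)) \<le> (\<Sum>i<n. f p' (X i \<omega>))"
                using pos [OF p(1)] by (simp add: h_def sum_subtractf)
              then show ?thesis by (simp add: F_def divide_right_mono)
            qed
            have "\<bar>Z n \<omega> - Y n \<omega>\<bar> \<le> K * r"
              using n K elim by (intro det r dev sphere) auto
            then show False using \<omega> r by simp
          qed
        qed
        show "?A n \<union> (\<Union>p\<in>T. ?B p n) \<in> sets M"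
          using T meas_B by (intro sets.Un sets.finite_UN) (auto, measurable)
      qed
      also have "\<dots> \<le> prob (?A n) + prob (\<Union>p\<in>T. ?B p n)"
        using T meas_B by (intro measure_Un_le sets.finite_UN) (auto, measurable)
      also have "prob (\<Union>p\<in>T. ?B p n) \<le> (\<Sum>p\<in>T. prob (?B p n))"
        using T meas_B by (intro measure_UNION_le) auto
      also have "prob (?A n) \<le> W / K\<^sup>2"
      proof -
        have "prob (?A n) \<le> real n * W / (K * sqrt (real n))\<^sup>2"
          unfolding W_def m_def using n K by (intro iid_sum_tail [OF M indep distr g g_sq]) auto
        also have "\<dots> = W / K\<^sup>2" using n by (simp add: power_mult_distrib)
        finally show ?thesis .
      qed
      also note WK
      also have "(\<Sum>p\<in>T. prob (?B p n)) < e / 2" using n1 [of n] n by simp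
      finally show ?thesis by simp
    qed
    then show "\<exists>no. \<forall>n\<ge>no. norm (prob {\<omega>\<in>space M. \<epsilon> < \<bar>Z n \<omega> - Y n \<omega>\<bar>} - 0) < e"
      by (intro exI [of _ "max 1 n1"]) auto
  qed
  then have "weak_conv_m (\<lambda>n. distr M borel (Z n)) (normal_law 0 (P.variance (f q)))"
    by (intro weak_conv_m_close [OF _ _ real_distribution_normal_law Y_lim] P.variance_positive) auto
  then show ?thesis
    by (simp add: Z_def [abs_def] V_def F_def v_def)
qed

section \<open>The limit law of the minimal value\<close>

text \<open>This makes the empirical minimal value measurable: the infimum runs over an uncountable set of
matrices, but a countable dense subset suffices.\<close>
lemma INF_eq_INF_dense:
  fixes F :: "'a::metric_space \<Rightarrow> real"
  assumes "D \<subseteq> C" "C \<subseteq> closure D" "continuous_on C F" "C \<noteq> {}" and nonneg: "\<And>p. p \<in> C \<Longrightarrow> 0 \<le> F p"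
  shows "(INF p\<in>C. F p) = (INF p\<in>D. F p)"
proof (rule antisym)
  have bdd: "bdd_below (F ` C)" using nonneg by (intro bdd_belowI2 [of _ 0])
  then have bddD: "bdd_below (F ` D)" using \<open>D \<subseteq> C\<close> by (meson bdd_below_mono image_mono)
  have "D \<noteq> {}" using assms(2,4) by auto
  then show "(INF p\<in>C. F p) \<le> (INF p\<in>D. F p)"
    using bdd \<open>D \<subseteq> C\<close> by (intro cINF_superset_mono) auto
  show "(INF p\<in>D. F p) \<le> (INF p\<in>C. F p)"
  proof (rule cINF_greatest [OF \<open>C \<noteq> {}\<close>])
    fix p assume p: "p \<in> C"
    then have "p \<in> closure D" using assms(2) by blast
    then obtain x where x: "\<And>n. x n \<in> D" "x \<longlonglongrightarrow> p"
      unfolding closure_sequential by blast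
    have "(\<lambda>n. F (x n)) \<longlonglongrightarrow> F p"
      using assms(3) p x \<open>D \<subseteq> C\<close> unfolding continuous_on_sequentially o_def by blast
    then show "(INF p\<in>D. F p) \<le> F p"
      by (rule LIMSEQ_le_const) (use x bddD in \<open>auto intro: cINF_lower\<close>)
  qed
qed

theorem theorem2p4:
  fixes P :: "(complex^'d^'d) measure"
    and A :: "(complex^'d^'d) set"
    and M :: "'w measure"
    and S :: "nat \<Rightarrow> 'w \<Rightarrow> complex^'d^'d"
  assumes "prob_space P"
    and "sets P = sets (restrict_space borel pos_semidef)"
    and "integrable P (\<lambda>S. (re_trace S)\<^sup>2)"
    and "measure P pos_def = 1"
    and "A \<subseteq> hermitian" and "affine A" and "pos_def \<inter> A \<noteq> {}"
    and "prob_space M"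
    and "prob_space.indep_vars M (\<lambda>_. P) S UNIV"
    and "\<And>i. distr M P (S i) = P"
  shows "(\<exists>Qs. psd_minimizer A (population_obj P) Qs \<and>
            (\<forall>Q. psd_minimizer A (population_obj P) Q \<longrightarrow> Q = Qs) \<and>
            weak_conv_m
              (\<lambda>n. distr M borel (\<lambda>\<omega>. sqrt (real n) *
                 (psd_min_value A (empirical_obj (\<lambda>i. S i \<omega>) n)
                  - psd_min_value A (population_obj P))))
              (normal_law 0 (prob_space.variance P (\<lambda>S. bw_dist_sq Qs S)))) \<and>
         (\<forall>n\<ge>1. \<forall>\<omega>\<in>space M. \<exists>Q. psd_minimizer A (empirical_obj (\<lambda>i. S i \<omega>) n) Q)"
proof -
  interpret bures_wasserstein_model P
    using assms(1-4) by (intro bures_wasserstein_model.intro bures_wasserstein_model_axioms.intro)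
  interpret M: prob_space M by (rule assms(8))
  have closed_A: "closed A"
    using closed_affine_hull [of A] affine_hull_eq [of A] \<open>affine A\<close> by metis
  have nonempty: "pos_semidef \<inter> A \<noteq> {}" using assms(7) pos_def_imp_psd by blast
  have S_meas: "S i \<in> measurable M P" for i using assms(9) by (simp add: M.indep_vars_def)
  have S_psd: "S i \<omega> \<in> pos_semidef" if "\<omega> \<in> space M" for i \<omega>
    using measurable_space [OF S_meas that] by (simp add: space_P)
  have emp_cont: "continuous_on pos_semidef (empirical_obj (\<lambda>i. S i \<omega>) n)" if "\<omega> \<in> space M" for n \<omega>
    unfolding empirical_obj_def using S_psd [OF that]
    by (intro continuous_intros continuous_on_bw_dist_sq_left)
  have emp_nonneg: "0 \<le> empirical_obj (\<lambda>i. S i \<omega>) n Q" if "\<omega> \<in> space M" "Q \<in> pos_semidef" for n \<omega> Q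
    unfolding empirical_obj_def using S_psd [OF that(1)] that(2)
    by (intro mult_nonneg_nonneg sum_nonneg bw_dist_sq_nonneg) auto

  obtain Qs where Qs: "psd_minimizer A (population_obj P) Qs"
    using population_minimizer_exists closed_A nonempty by blast
  have unique: "Q = Qs" if "psd_minimizer A (population_obj P) Q" for Q
    using minimizer_unique that Qs assms(6,7) by blast
  have Qs_pd: "Qs \<in> pos_def" using minimizer_pos_def Qs assms(6,7) by blast
  have Qs_in: "Qs \<in> pos_semidef \<inter> A" using psd_minimizerD(1) [OF Qs] .
  obtain \<delta>2 where \<delta>2: "0 < \<delta>2" "Qs - \<delta>2 *\<^sub>R mat 1 \<in> pos_semidef" using pos_def_lower_bound Qs_pd .
  define \<delta> where "\<delta> = \<delta>2 / 2"
  have \<delta>: "0 < \<delta>" using \<delta>2 by (simp add: \<delta>_def)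
  have near: "Q - \<delta> *\<^sub>R mat 1 \<in> pos_semidef" if "Q \<in> (pos_semidef \<inter> A) \<inter> cball Qs \<delta>" for Q
    using psd_lower_bound_perturb [OF \<delta>2(2), of Q \<delta>] that
    by (auto simp: \<delta>_def dist_norm norm_minus_commute pos_semidef_def)

  have value_meas: "(\<lambda>\<omega>. psd_min_value A (empirical_obj (\<lambda>i. S i \<omega>) n)) \<in> borel_measurable M" for n
  proof -
    obtain D where D: "countable D" "D \<subseteq> pos_semidef \<inter> A" "pos_semidef \<inter> A \<subseteq> closure D"
      using separable by blast
    have "(\<lambda>\<omega>. INF Q\<in>D. empirical_obj (\<lambda>i. S i \<omega>) n Q) \<in> borel_measurable M"
    proof (rule borel_measurable_cINF_real [OF D(1)])
      fix Q assume "Q \<in> D"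
      then have "bw_dist_sq Q \<in> borel_measurable P" using D(2) by (intro bw_measurable) auto
      then show "(\<lambda>\<omega>. empirical_obj (\<lambda>i. S i \<omega>) n Q) \<in> borel_measurable M"
        unfolding empirical_obj_def
        by (intro borel_measurable_times borel_measurable_const borel_measurable_sum
            measurable_compose [OF S_meas])
    qed
    moreover have "psd_min_value A (empirical_obj (\<lambda>i. S i \<omega>) n)
        = (INF Q\<in>D. empirical_obj (\<lambda>i. S i \<omega>) n Q)" if "\<omega> \<in> space M" for \<omega>
      unfolding psd_min_value_def
      using continuous_on_subset [OF emp_cont [OF that]] emp_nonneg [OF that]
      by (intro INF_eq_INF_dense D nonempty) auto
    ultimately show ?thesis by (simp cong: measurable_cong)
  qed

  have "weak_conv_m (\<lambda>n. distr M borel (\<lambda>\<omega>. sqrt (real n) *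
      ((INF Q\<in>pos_semidef \<inter> A. 1 / real n * (\<Sum>i<n. bw_dist_sq Q (S i \<omega>)))
        - (\<integral>S. bw_dist_sq Qs S \<partial>P))))
    (normal_law 0 (variance (bw_dist_sq Qs)))"
  proof (rule convex_value_central_limit [where \<eta> = \<delta>
        and g = "\<lambda>S. mat 1 - ot_map Qs S"
        and L = "\<lambda>S. norm (mat 1 :: complex^'d^'d) + sqrt (re_trace S / \<delta>)"])
    show "closed (pos_semidef \<inter> A)" using closed_psd closed_A by (rule closed_Int)
    show "integrable P (\<lambda>S. (bw_dist_sq Q S)\<^sup>2)" "bw_dist_sq Q \<in> borel_measurable P"
      if "Q \<in> pos_semidef \<inter> A" for Q
      using that by (auto intro: bw_sq_integrable bw_measurable)
    show "(\<lambda>S. mat 1 - ot_map Qs S) \<in> borel_measurable P"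
      using ot_map_measurable [OF Qs_pd] by measurable
    show "integrable P (\<lambda>S. (norm (mat 1 - ot_map Qs S))\<^sup>2)"
      by (rule gradient_sq_integrable [OF Qs_pd])
    show "integrable P (\<lambda>S. (norm (mat 1 :: complex^'d^'d) + sqrt (re_trace S / \<delta>))\<^sup>2)"
      by (rule sqrt_trace_sq_integrable [OF \<delta>])
    show "AE S in P. convex_on (pos_semidef \<inter> A) (\<lambda>Q. bw_dist_sq Q S)"
      using AE_pos_def
    proof eventually_elim
      case (elim S)
      have "convex (pos_semidef \<inter> A)"
        using affine_imp_convex [OF assms(6)] by (rule convex_Int [OF convex_psd])
      then show ?case
        using convex_on_bw_dist_sq [OF elim] by (auto intro: convex_on_subset)
    qed
    show "AE S in P. \<forall>Q\<in>pos_semidef \<inter> A. 0 \<le> bw_dist_sq Q S"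
      by (intro AE_I2) (auto simp: space_P bw_dist_sq_nonneg)
    show "AE S in P. \<forall>Q\<in>pos_semidef \<inter> A.
        bw_dist_sq Qs S + (mat 1 - ot_map Qs S) \<bullet> (Q - Qs) \<le> bw_dist_sq Q S"
      using AE_pos_def by eventually_elim (auto intro: bw_dist_sq_subgradient Qs_pd)
    show "AE S in P. 0 \<le> norm (mat 1 :: complex^'d^'d) + sqrt (re_trace S / \<delta>) \<and>
        (\<forall>Q\<in>(pos_semidef \<inter> A) \<inter> cball Qs \<delta>. \<forall>Q'\<in>(pos_semidef \<inter> A) \<inter> cball Qs \<delta>.
          bw_dist_sq Q S - bw_dist_sq Q' S
          \<le> (norm (mat 1 :: complex^'d^'d) + sqrt (re_trace S / \<delta>)) * norm (Q - Q'))"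
      using AE_pos_def
    proof eventually_elim
      case (elim S)
      have "0 \<le> re_trace S" using elim by (intro re_trace_psd_nonneg pos_def_imp_psd)
      then show ?case
        using bw_dist_sq_lipschitz [OF \<delta> elim near near] \<delta> by simp
    qed
    show "0 \<le> (\<integral>S. mat 1 - ot_map Qs S \<partial>P) \<bullet> (Q - Qs)" if "Q \<in> pos_semidef \<inter> A" for Q
      using minimizer_first_order [OF Qs assms(6) Qs_pd that] .
    show "(\<integral>S. bw_dist_sq Qs S \<partial>P) < (\<integral>S. bw_dist_sq Q S \<partial>P)"
      if "Q \<in> pos_semidef \<inter> A" "Q \<noteq> Qs" for Q
    proof (rule ccontr)
      assume "\<not> ?thesis"
      then have "population_obj P Q \<le> population_obj P Qs" by (simp add: population_obj_def)
      then have "psd_minimizer A (population_obj P) Q"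
        using that(1) psd_minimizerD(2) [OF Qs]
        unfolding psd_minimizer_def is_arg_min_def by (meson not_less order_trans)
      then show False using unique that(2) by blast
    qed
    show "(\<lambda>\<omega>. INF Q\<in>pos_semidef \<inter> A. 1 / real n * (\<Sum>i<n. bw_dist_sq Q (S i \<omega>)))
        \<in> borel_measurable M" for n
      using value_meas [of n] by (simp add: psd_min_value_def empirical_obj_def)
  qed (use assms \<delta> Qs_in in \<open>auto intro: borel_measurable_add\<close>)
  then have clt: "weak_conv_m (\<lambda>n. distr M borel (\<lambda>\<omega>. sqrt (real n) *
      (psd_min_value A (empirical_obj (\<lambda>i. S i \<omega>) n) - psd_min_value A (population_obj P))))
    (normal_law 0 (variance (\<lambda>S. bw_dist_sq Qs S)))"
    unfolding psd_min_value_eq [OF Qs] by (simp add: psd_min_value_def empirical_obj_def population_obj_def)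

  have "\<exists>Q. psd_minimizer A (empirical_obj (\<lambda>i. S i \<omega>) n) Q" if "1 \<le> n" "\<omega> \<in> space M" for n \<omega>
  proof (rule psd_minimizer_exists [OF closed_A nonempty emp_cont [OF that(2)], where c = "1 / 2"])
    fix Q :: "complex^'d^'d" assume Q: "Q \<in> pos_semidef"
    have "(\<Sum>i<n. re_trace Q / 2 - re_trace (S i \<omega>)) \<le> (\<Sum>i<n. bw_dist_sq Q (S i \<omega>))"
      using Q S_psd [OF that(2)] by (intro sum_mono bw_dist_sq_coercive)
    from divide_right_mono [OF this, of "real n"]
    show "1 / 2 * re_trace Q - (\<Sum>i<n. re_trace (S i \<omega>)) / real n \<le> empirical_obj (\<lambda>i. S i \<omega>) n Q"
      using that(1) by (simp add: empirical_obj_def sum_subtractf diff_divide_distrib)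
  qed simp
  then show ?thesis using Qs unique clt by blast
qed

end
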